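(* Let $1\leq p_1,p_2,q<\infty$ and $-1/p_1\leq\lambda<0$. Suppose that $w\in A_q(\mathbb{H}^n)$, with critical index $r_w$ for the reverse Hölder condition. If $p_1>p_2\,q\,r_w/(r_w-1)$, then for any $1<\delta<r_w$ there is a constant $C>0$, independent of $f$, $\Phi$ and $A$, such that $$\Vert \mathcal{H}_{\Phi,A}f\Vert_{\dot{L}^{p_2,\lambda}(\mathbb{H}^n;w)}\leq C\,C_1\,\Vert f\Vert_{\dot{L}^{p_1,\lambda}(\mathbb{H}^n;w)},$$ where $$C_1=\int_{\Vert A(y)\Vert>1}\frac{|\Phi(y)|}{|y|_h^{Q}}\left(\frac{\Vert A(y)\Vert^{Q}}{|\det A(y)|}\right)^{q/p_1}\Vert A(y)\Vert^{Q\lambda(\delta-1)/\delta}\,dy+\int_{\Vert A(y)\Vert\leq 1}\frac{|\Phi(y)|}{|y|_h^{Q}}\left(\frac{\Vert A(y)\Vert^{Q}}{|\det A(y)|}\right)^{q/p_1}\Vert A(y)\Vert^{Q\lambda q}\,dy.$$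
   Context: The Heisenberg group $\mathbb{H}^n$ is $\mathbf{R}^{2n}\times\mathbf{R}$ with group law $x\cdot y=\big(x_1+y_1,\dots,x_{2n}+y_{2n},\,x_{2n+1}+y_{2n+1}+2\sum_{j=1}^n(y_jx_{n+j}-x_jy_{n+j})\big)$; the inverse of $x$ is $-x$; Haar measure is Lebesgue measure $dx$, and $|E|$ is the measure of $E$. $Q=2n+2$ is the homogeneous dimension. The norm is $|x|_h=\big[(\sum_{i=1}^{2n}x_i^2)^2+x_{2n+1}^2\big]^{1/4}$, the distance is $d(p,q)=|q^{-1}p|_h$, and $B(x,r)=\{y: d(x,y)<r\}$. For a $(2n+1)\times(2n+1)$ real matrix $M$ (acting on $\mathbf{R}^{2n+1}$), $\Vert M\Vert=\sup_{x\in\mathbb{H}^n,\,x\neq0}|Mx|_h/|x|_h$. $\Phi$ is a locally integrable function on $\mathbb{H}^n$, and $A(y)$ is a function on $\mathbb{H}^n$ with values in $(2n+1)\times(2n+1)$ matrices with $\det A(y)\neq0$ for almost every $y$ in the support of $\Phi$. The Hausdorff operator is $\mathcal{H}_{\Phi,A}f(x)=\int_{\mathbb{H}^n}\frac{\Phi(y)}{|y|_h^Q}f(A(y)x)\,dy$. A weight $w$ is a nonnegative locally integrable function on $\mathbb{H}^n$; $w(E)=\int_E w(x)\,dx$. For $1<p<\infty$, $w\in A_p(\mathbb{H}^n)$ if there is $C$ with $\left(\frac1{|B|}\int_Bw\,dx\right)\left(\frac1{|B|}\int_Bw^{-1/(p-1)}dx\right)^{p-1}\leq C$ for all balls $B$;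 $w\in A_1(\mathbb{H}^n)$ if there is $C$ with $\frac1{|B|}\int_Bw\,dx\leq C\,\mathrm{ess\,inf}_{x\in B}w(x)$ for all balls $B$. For $r>1$, $w\in RH_r(\mathbb{H}^n)$ if there is $C$ with $\left(\frac1{|B|}\int_Bw^r\,dx\right)^{1/r}\leq\frac{C}{|B|}\int_Bw\,dx$ for all balls $B$. The critical index for the reverse Hölder condition is $r_w=\sup\{r>1: w\in RH_r(\mathbb{H}^n)\}$ (when $r_w=\infty$, $r_w/(r_w-1)$ is read as $1$). For $1\leq p<\infty$ and $-1/p\leq\lambda<0$, the weighted central Morrey space $\dot{L}^{p,\lambda}(\mathbb{H}^n;w)$ consists of $f\in L^p_{loc}(\mathbb{H}^n;w)$ with $\Vert f\Vert_{\dot{L}^{p,\lambda}(\mathbb{H}^n;w)}=\sup_{r>0}\left(\frac{1}{w(B(0,r))^{1+p\lambda}}\int_{B(0,r)}|f(x)|^pw(x)\,dx\right)^{1/p}<\infty$. *)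

theory Defs
  imports "HOL-Analysis.Analysis"
begin

section \<open>The Heisenberg group\<close>

text \<open>
  The group of topological dimension \<open>2n + 1\<close>, where \<open>n = CARD('n)\<close>.  Coordinates are
  indexed by \<open>('n + 'n) option\<close>: the index \<open>Some (Inl j)\<close> stands for \<open>j\<close>,
  \<open>Some (Inr j)\<close> for \<open>n + j\<close>, and \<open>None\<close> for \<open>2n + 1\<close>.
\<close>

type_synonym 'n heis = "real ^ (('n + 'n) option)"

type_synonym 'n heis_matrix = "real ^ (('n + 'n) option) ^ (('n + 'n) option)"

definition hmult :: "'n::finite heis \<Rightarrow> 'n heis \<Rightarrow> 'n heis" where
  "hmult x y = (\<chi> k. case k of
      Some i \<Rightarrow> x $ Some i + y $ Some i
    | None \<Rightarrow> x $ None + y $ None +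
        2 * (\<Sum>j\<in>UNIV. y $ Some (Inl j) * x $ Some (Inr j) - x $ Some (Inl j) * y $ Some (Inr j)))"

definition hinv :: "'n::finite heis \<Rightarrow> 'n heis" where
  "hinv x = - x"

definition hnorm :: "'n::finite heis \<Rightarrow> real" where
  "hnorm x = root 4 ((\<Sum>i\<in>UNIV. (x $ Some i)\<^sup>2)\<^sup>2 + (x $ None)\<^sup>2)"

definition hdist :: "'n::finite heis \<Rightarrow> 'n heis \<Rightarrow> real" where
  "hdist p q = hnorm (hmult (hinv q) p)"

definition hball :: "'n::finite heis \<Rightarrow> real \<Rightarrow> 'n heis set" where
  "hball x r = {y. hdist x y < r}"

text \<open>The homogeneous dimension \<open>Q\<close>.\<close>

definition hdim :: "'n::finite itself \<Rightarrow> nat" where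
  "hdim _ = 2 * CARD('n) + 2"

text \<open>
  A linear map need not be compatible with the anisotropic dilations, so the supremum
  may be infinite; hence the values in \<^typ>\<open>ennreal\<close>.
\<close>

definition hopnorm :: "'n::finite heis_matrix \<Rightarrow> ennreal" where
  "hopnorm M = (SUP x\<in>{x. x \<noteq> 0}. ennreal (hnorm (M *v x) / hnorm x))"


section \<open>Weights\<close>

text \<open>
  Real powers of extended nonnegative numbers, with \<open>0\<close> to a negative power equal to
  \<open>\<infinity>\<close> (whereas \<^term>\<open>(0::real) powr a = 0\<close>).
\<close>

definition ennpowr :: "ennreal \<Rightarrow> real \<Rightarrow> ennreal" where
  "ennpowr x a =
    (if a = 0 then 1
     else if x = 0 then (if a > 0 then 0 else \<infinity>)
     else if x = \<infinity> then (if a > 0 then \<infinity> else 0)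
     else ennreal (enn2real x powr a))"

definition locally_integrable :: "('n::finite heis \<Rightarrow> 'b::{banach, second_countable_topology}) \<Rightarrow> bool" where
  "locally_integrable f \<longleftrightarrow> (\<forall>K. compact K \<longrightarrow> set_integrable lebesgue K f)"

definition weight :: "('n::finite heis \<Rightarrow> real) \<Rightarrow> bool" where
  "weight w \<longleftrightarrow> (\<forall>x. 0 \<le> w x) \<and> locally_integrable w"

definition weight_measure :: "('n::finite heis \<Rightarrow> real) \<Rightarrow> 'n heis measure" where
  "weight_measure w = density lebesgue (\<lambda>x. ennreal (w x))"

definition average :: "'n::finite heis set \<Rightarrow> ('n heis \<Rightarrow> ennreal) \<Rightarrow> ennreal" where
  "average E g = (\<integral>\<^sup>+x\<in>E. g x \<partial>lebesgue) / emeasure lebesgue E"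

definition ess_inf :: "'n::finite heis set \<Rightarrow> ('n heis \<Rightarrow> ennreal) \<Rightarrow> ennreal" where
  "ess_inf E g = Sup {c. AE x in lebesgue. x \<in> E \<longrightarrow> c \<le> g x}"

definition A1_weights :: "('n::finite heis \<Rightarrow> real) set" where
  "A1_weights = {w. weight w \<and> (\<exists>C::real. \<forall>x r. r > 0 \<longrightarrow>
      average (hball x r) (\<lambda>y. ennreal (w y))
        \<le> ennreal C * ess_inf (hball x r) (\<lambda>y. ennreal (w y)))}"

definition Ap_weights :: "real \<Rightarrow> ('n::finite heis \<Rightarrow> real) set" where
  "Ap_weights p =
    (if p = 1 then A1_weights
     else {w. weight w \<and> (\<exists>C::real. \<forall>x r. r > 0 \<longrightarrow>
        average (hball x r) (\<lambda>y. ennreal (w y)) *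
        ennpowr (average (hball x r) (\<lambda>y. ennpowr (ennreal (w y)) (- 1 / (p - 1)))) (p - 1)
          \<le> ennreal C)})"

definition RH_weights :: "real \<Rightarrow> ('n::finite heis \<Rightarrow> real) set" where
  "RH_weights r = {w. weight w \<and> (\<exists>C::real. \<forall>x \<rho>. \<rho> > 0 \<longrightarrow>
      ennpowr (average (hball x \<rho>) (\<lambda>y. ennpowr (ennreal (w y)) r)) (1 / r)
        \<le> ennreal C * average (hball x \<rho>) (\<lambda>y. ennreal (w y)))}"

definition rh_index :: "('n::finite heis \<Rightarrow> real) \<Rightarrow> ereal" where
  "rh_index w = Sup (ereal ` {r. r > 1 \<and> w \<in> RH_weights r})"

text \<open>The number \<open>r / (r - 1)\<close>, read as \<open>1\<close> for \<open>r = \<infinity>\<close>.\<close>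

definition conj_index :: "ereal \<Rightarrow> real" where
  "conj_index r = (if r = \<infinity> then 1 else real_of_ereal r / (real_of_ereal r - 1))"


section \<open>Weighted central Morrey spaces\<close>

definition Lp_loc :: "real \<Rightarrow> ('n::finite heis \<Rightarrow> real) \<Rightarrow> ('n heis \<Rightarrow> complex) set" where
  "Lp_loc p w = {f. f \<in> borel_measurable lebesgue \<and>
      (\<forall>K. compact K \<longrightarrow> (\<integral>\<^sup>+x\<in>K. ennreal (norm (f x) powr p * w x) \<partial>lebesgue) < \<infinity>)}"

definition morrey_norm ::
    "real \<Rightarrow> real \<Rightarrow> ('n::finite heis \<Rightarrow> real) \<Rightarrow> ('n heis \<Rightarrow> complex) \<Rightarrow> ennreal" where
  "morrey_norm p l w f =
    (SUP r\<in>{0<..}. ennpowr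
      (1 / ennpowr (emeasure (weight_measure w) (hball 0 r)) (1 + p * l) *
        (\<integral>\<^sup>+x\<in>hball 0 r. ennreal (norm (f x) powr p * w x) \<partial>lebesgue))
      (1 / p))"

definition morrey_space :: "real \<Rightarrow> real \<Rightarrow> ('n::finite heis \<Rightarrow> real) \<Rightarrow> ('n heis \<Rightarrow> complex) set" where
  "morrey_space p l w = {f \<in> Lp_loc p w. morrey_norm p l w f < \<infinity>}"


section \<open>Hausdorff operators\<close>

definition hausdorff_integrand ::
    "('n::finite heis \<Rightarrow> complex) \<Rightarrow> ('n heis \<Rightarrow> 'n heis_matrix) \<Rightarrow> ('n heis \<Rightarrow> complex)
      \<Rightarrow> 'n heis \<Rightarrow> 'n heis \<Rightarrow> complex" where
  "hausdorff_integrand \<Phi> A f x y =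
    \<Phi> y / complex_of_real (hnorm y ^ hdim TYPE('n)) * f (A y *v x)"

definition hausdorff ::
    "('n::finite heis \<Rightarrow> complex) \<Rightarrow> ('n heis \<Rightarrow> 'n heis_matrix) \<Rightarrow> ('n heis \<Rightarrow> complex)
      \<Rightarrow> 'n heis \<Rightarrow> complex" where
  "hausdorff \<Phi> A f x = (\<integral>y. hausdorff_integrand \<Phi> A f x y \<partial>lebesgue)"

text \<open>
  The factor \<open>(\<parallel>M\<parallel>\<^sup>Q / |det M|)\<^sup>a \<parallel>M\<parallel>\<^sup>b\<close>.  Where \<open>\<parallel>M\<parallel> > 1\<close> in the definition below,
  \<open>Q a + b > 0\<close> if \<open>q \<ge> 1\<close> and \<open>-1/p\<^sub>1 \<le> l\<close>, so the factor is \<open>\<infinity>\<close> when \<open>\<parallel>M\<parallel> = \<infinity>\<close>; multiplying the two powers separately would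
  instead produce \<open>\<infinity> * 0\<close>, which is \<open>0\<close> in \<^typ>\<open>ennreal\<close>.
\<close>

definition matrix_factor :: "real \<Rightarrow> real \<Rightarrow> 'n::finite heis_matrix \<Rightarrow> ennreal" where
  "matrix_factor a b M =
    (if hopnorm M = \<infinity> then \<infinity>
     else ennreal ((enn2real (hopnorm M) ^ hdim TYPE('n) / \<bar>det M\<bar>) powr a
                   * enn2real (hopnorm M) powr b))"

definition hausdorff_const ::
    "real \<Rightarrow> real \<Rightarrow> real \<Rightarrow> real \<Rightarrow> ('n::finite heis \<Rightarrow> complex) \<Rightarrow> ('n heis \<Rightarrow> 'n heis_matrix) \<Rightarrow> ennreal" where
  "hausdorff_const p\<^sub>1 q l \<delta> \<Phi> A =
    (\<integral>\<^sup>+y\<in>{y. hopnorm (A y) > 1}. ennreal (norm (\<Phi> y) / hnorm y ^ hdim TYPE('n)) *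
        matrix_factor (q / p\<^sub>1) (real (hdim TYPE('n)) * l * (\<delta> - 1) / \<delta>) (A y) \<partial>lebesgue) +
    (\<integral>\<^sup>+y\<in>{y. hopnorm (A y) \<le> 1}. ennreal (norm (\<Phi> y) / hnorm y ^ hdim TYPE('n)) *
        matrix_factor (q / p\<^sub>1) (real (hdim TYPE('n)) * l * q) (A y) \<partial>lebesgue)"

end

theory Submission
  imports Defs
begin

text \<open>
  Write \<open>B\<^sub>r = B(0, r)\<close>.  Only balls around the origin occur in the Morrey norm, so the two
  hypotheses on the weight enter through two elementary inequalities on such balls:
  \<^item> the Muckenhoupt condition gives \<open>(avg\<^sub>B g)\<^sup>q w(B) \<le> C \<integral>\<^sub>B g\<^sup>q w\<close>
    (\<open>Ap_average_le\<close>);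
  \<^item> the reverse Hoelder condition with exponent \<open>s\<close> gives
    \<open>\<integral>\<^sub>B h w \<le> C (avg\<^sub>B h\<^sup>a)\<^sup>1\<^sup>/\<^sup>a w(B)\<close>, where \<open>a = s / (s - 1)\<close> (\<open>RH_nn_integral_le\<close>).

  For indicator functions of balls they say that \<open>w(B\<^sub>m\<^sub>r) / w(B\<^sub>r)\<close> is at least a constant times
  \<open>m\<^sup>Q\<^sup>q\<close> for \<open>m \<le> 1\<close> and \<open>m\<^sup>Q\<^sup>(\<^sup>\<delta>\<^sup>-\<^sup>1\<^sup>)\<^sup>/\<^sup>\<delta>\<close> for \<open>m > 1\<close> (\<open>weight_growth_neg_power\<close>).

  Fix an invertible matrix \<open>M\<close> with \<open>m = \<parallel>M\<parallel> < \<infinity>\<close>.  The exponent \<open>a = p\<^sub>1 / (p\<^sub>2 q)\<close> is the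
  conjugate of some \<open>s < r\<^sub>w\<close> by hypothesis.  Therefore
  \<open>\<integral> |f(M x)|\<^sup>p\<^sup>2 w dx\<close> over \<open>B\<^sub>r\<close> is bounded in terms of \<open>w(B\<^sub>r)\<close> and the average of
  \<open>|f(M x)|\<^sup>p\<^sup>1\<^sup>/\<^sup>q\<close> over \<open>B\<^sub>r\<close>, which the
  substitution \<open>z = M x\<close> bounds by \<open>m\<^sup>Q / |det M|\<close> times the average of \<open>|f|\<^sup>p\<^sup>1\<^sup>/\<^sup>q\<close> over \<open>B\<^sub>m\<^sub>r\<close>, and
  this in turn is bounded by the weighted integral of \<open>|f|\<^sup>p\<^sup>1\<close> over \<open>B\<^sub>m\<^sub>r\<close>, hence by the Morrey norm
  of \<open>f\<close> and a power of \<open>w(B\<^sub>m\<^sub>r)\<close>.  Comparing \<open>w(B\<^sub>m\<^sub>r)\<close> with \<open>w(B\<^sub>r)\<close> produces exactly the factor of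
  \<open>M\<close> in the constant \<open>C\<^sub>1\<close> (\<open>matrix_composition_estimate\<close>).  Minkowski's integral inequality
  sums these bounds over \<open>y\<close> with \<open>M = A y\<close> (\<open>hausdorff_nn_integral_le\<close>).

  Two points need care.  The function \<open>f\<close> is only Lebesgue measurable, so it is replaced by a
  Borel function that agrees with it almost everywhere; since the matrices are invertible, this
  changes the operator only on a null set of points \<open>x\<close>.  And \<open>w\<close> may vanish identically
  almost everywhere, in which case all norms are zero; otherwise it is positive almost
  everywhere (\<open>Ap_weight_zero_or_pos\<close>), and every ball around the origin has positive
  finite weight.
\<close>

section \<open>Real powers of extended nonnegative numbers\<close>

lemma ennreal_cases_pos:
  obtains "x = 0" | "x = top" | r where "0 < r" "x = ennreal r"
  by (cases x) (auto simp: ennreal_eq_0_iff less_le)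

lemma ennpowr_zero_right [simp]: "ennpowr x 0 = 1"
  by (simp add: ennpowr_def)

lemma ennpowr_zero_left: "ennpowr 0 a = (if a = 0 then 1 else if a > 0 then 0 else top)"
  by (simp add: ennpowr_def)

lemma ennpowr_top_left: "ennpowr top a = (if a = 0 then 1 else if a > 0 then top else 0)"
  by (simp add: ennpowr_def)

lemma ennpowr_ennreal: "0 < r \<Longrightarrow> ennpowr (ennreal r) a = ennreal (r powr a)"
  by (simp add: ennpowr_def)

lemma ennpowr_ennreal_nonneg: "0 \<le> r \<Longrightarrow> 0 < a \<Longrightarrow> ennpowr (ennreal r) a = ennreal (r powr a)"
  by (cases "r = 0") (auto simp: ennpowr_ennreal ennpowr_zero_left)

lemma ennpowr_one_right [simp]: "ennpowr x 1 = x"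
  by (cases x rule: ennreal_cases_pos)
     (auto simp: ennpowr_zero_left ennpowr_top_left ennpowr_ennreal)

lemma ennpowr_one_left [simp]: "ennpowr 1 a = 1"
  using ennpowr_ennreal[of 1 a] by simp

lemma ennpowr_ennpowr: "ennpowr (ennpowr x a) b = ennpowr x (a * b)"
  by (cases x rule: ennreal_cases_pos)
     (auto simp: ennpowr_zero_left ennpowr_top_left ennpowr_ennreal powr_powr
           mult_less_0_iff zero_less_mult_iff)

text \<open>
  For \<open>a < 0\<close> the rule fails at \<open>0 * \<infinity> = 0\<close>, where the left-hand side is \<open>\<infinity>\<close> and the
  right-hand side is \<open>\<infinity> * 0 = 0\<close>.
\<close>
lemma ennpowr_mult: "0 \<le> a \<Longrightarrow> ennpowr (x * y) a = ennpowr x a * ennpowr y a"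
  by (cases x rule: ennreal_cases_pos; cases y rule: ennreal_cases_pos)
     (auto simp: ennpowr_zero_left ennpowr_top_left ennpowr_ennreal powr_mult
        ennreal_mult_top ennreal_top_mult simp flip: ennreal_mult)

text \<open>
  Exponents of opposite signs have to be excluded at \<open>0\<close> and \<open>\<infinity>\<close>, because \<open>0 * \<infinity> = 0\<close>
  differs from the zeroth power \<open>1\<close>.
\<close>
lemma ennpowr_add:
  assumes "(0 \<le> a \<and> 0 \<le> b) \<or> (x \<noteq> 0 \<and> x \<noteq> top)"
  shows "ennpowr x (a + b) = ennpowr x a * ennpowr x b"
  using assms
  by (cases x rule: ennreal_cases_pos)
     (auto simp: ennpowr_zero_left ennpowr_top_left ennpowr_ennreal powr_add
        ennreal_mult_top ennreal_top_mult simp flip: ennreal_mult)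

lemma ennpowr_mono: "0 \<le> a \<Longrightarrow> x \<le> y \<Longrightarrow> ennpowr x a \<le> ennpowr y a"
  by (cases x rule: ennreal_cases_pos; cases y rule: ennreal_cases_pos)
     (auto simp: ennpowr_zero_left ennpowr_top_left ennpowr_ennreal powr_mono2 top_unique)

lemma ennpowr_eq_0_iff: "0 < a \<Longrightarrow> ennpowr x a = 0 \<longleftrightarrow> x = 0"
  by (cases x rule: ennreal_cases_pos)
     (auto simp: ennpowr_zero_left ennpowr_top_left ennpowr_ennreal)

lemma ennpowr_eq_top_iff: "0 < a \<Longrightarrow> ennpowr x a = top \<longleftrightarrow> x = top"
  by (cases x rule: ennreal_cases_pos)
     (auto simp: ennpowr_zero_left ennpowr_top_left ennpowr_ennreal)

lemma ennpowr_finite: "x \<noteq> 0 \<Longrightarrow> x \<noteq> top \<Longrightarrow> ennpowr x a \<noteq> 0 \<and> ennpowr x a \<noteq> top"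
  by (cases x rule: ennreal_cases_pos) (auto simp: ennpowr_ennreal)

lemma measurable_ennpowr [measurable (raw)]:
  assumes [measurable]: "f \<in> borel_measurable M"
  shows "(\<lambda>x. ennpowr (f x) a) \<in> borel_measurable M"
  unfolding ennpowr_def by measurable


section \<open>Integral inequalities\<close>

lemma Youngs_inequality_ennreal:
  fixes x y :: ennreal
  assumes "p > 1" "q > 1" "1 / p + 1 / q = 1"
  shows "x * y \<le> ennreal (1 / p) * ennpowr x p + ennreal (1 / q) * ennpowr y q"
proof -
  consider "x = 0" | "y = 0" | "x \<noteq> 0" "y \<noteq> 0" "x = top \<or> y = top"
    | a b where "0 < a" "0 < b" "x = ennreal a" "y = ennreal b"
    by (metis ennreal_cases_pos)
  then show ?thesis
  proof cases
    case 3
    then show ?thesis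
      using assms by (auto simp: ennpowr_top_left ennreal_mult_top)
  next
    case 4
    then show ?thesis
      using assms Youngs_inequality[of p q a b]
      by (simp add: ennpowr_ennreal flip: ennreal_mult ennreal_plus)
  qed auto
qed

text \<open>
  If both norms are finite and positive, integrate Young's inequality for the two functions
  divided by their norms.
\<close>
lemma Hoelder_nn_integral:
  assumes pq: "p > 1" "q > 1" "1 / p + 1 / q = 1"
  assumes [measurable]: "f \<in> borel_measurable M" "g \<in> borel_measurable M"
  shows "(\<integral>\<^sup>+x. f x * g x \<partial>M)
    \<le> ennpowr (\<integral>\<^sup>+x. ennpowr (f x) p \<partial>M) (1 / p) * ennpowr (\<integral>\<^sup>+x. ennpowr (g x) q \<partial>M) (1 / q)"
proof -
  define F where "F = (\<integral>\<^sup>+x. ennpowr (f x) p \<partial>M)"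
  define G where "G = (\<integral>\<^sup>+x. ennpowr (g x) q \<partial>M)"
  have *: "(\<integral>\<^sup>+x. f x * g x \<partial>M) = 0" if "F = 0 \<or> G = 0"
  proof -
    from that have "AE x in M. f x * g x = 0"
      using pq unfolding F_def G_def
      by (auto simp: nn_integral_0_iff_AE ennpowr_eq_0_iff elim: eventually_mono)
    then show ?thesis
      by (simp add: nn_integral_0_iff_AE)
  qed
  consider "F = 0 \<or> G = 0" | "F \<noteq> 0" "G \<noteq> 0" "F = top \<or> G = top"
    | a b where "0 < a" "0 < b" "F = ennreal a" "G = ennreal b"
    by (metis ennreal_cases_pos)
  then show ?thesis
  proof cases
    case 1
    then show ?thesis using * by simp
  next
    case 2
    then show ?thesis
      using pq by (auto simp: F_def[symmetric] G_def[symmetric] ennpowr_top_left ennpowr_eq_0_iff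
        ennreal_mult_top ennreal_top_mult)
  next
    case (3 a b)
    define c d where "c = a powr (1 / p)" and "d = b powr (1 / q)"
    have cd: "c > 0" "d > 0" "c powr p = a" "d powr q = b"
      using pq 3 by (auto simp: c_def d_def powr_powr)
    have [simp]: "ennpowr (ennreal (1 / c)) p = ennreal (1 / a)" "ennpowr (ennreal (1 / d)) q = ennreal (1 / b)"
      using cd by (auto simp: ennpowr_ennreal powr_divide)
    have "(\<integral>\<^sup>+x. f x * g x \<partial>M) = (\<integral>\<^sup>+x. ennreal (c * d) * ((ennreal (1 / c) * f x) * (ennreal (1 / d) * g x)) \<partial>M)"
    proof (rule nn_integral_cong)
      fix x
      have "ennreal (c * d) * (ennreal (1 / c) * ennreal (1 / d)) = 1"
        using cd by (simp flip: ennreal_mult)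
      then show "f x * g x = ennreal (c * d) * ((ennreal (1 / c) * f x) * (ennreal (1 / d) * g x))"
        by (metis (no_types, lifting) mult.assoc mult.commute mult_1)
    qed
    also have "\<dots> = ennreal (c * d) * (\<integral>\<^sup>+x. (ennreal (1 / c) * f x) * (ennreal (1 / d) * g x) \<partial>M)"
      by (rule nn_integral_cmult) measurable
    also have "\<dots> \<le> ennreal (c * d) * (\<integral>\<^sup>+x. ennreal (1 / p) * ennpowr (ennreal (1 / c) * f x) p
        + ennreal (1 / q) * ennpowr (ennreal (1 / d) * g x) q \<partial>M)"
      by (intro mult_left_mono nn_integral_mono Youngs_inequality_ennreal pq) auto
    also have "(\<integral>\<^sup>+x. ennreal (1 / p) * ennpowr (ennreal (1 / c) * f x) p
        + ennreal (1 / q) * ennpowr (ennreal (1 / d) * g x) q \<partial>M)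
        = ennreal (1 / p) * (ennreal (1 / a) * F) + ennreal (1 / q) * (ennreal (1 / b) * G)"
      using pq by (simp add: ennpowr_mult nn_integral_add nn_integral_cmult F_def G_def)
    also have "\<dots> = 1"
      using 3 pq by (simp flip: ennreal_mult ennreal_plus)
    finally show ?thesis
      using 3 cd by (simp add: F_def[symmetric] G_def[symmetric] ennpowr_ennreal c_def d_def ennreal_mult)
  qed
qed

text \<open>
  Hoelder's inequality with the constant function \<open>1\<close> as second factor.  The total mass of
  \<open>M\<close> may be any value in \<open>[0, \<infinity>]\<close>; for \<open>p = 1\<close> the power of the mass is \<open>1\<close> by convention.
\<close>
lemma Jensen_ennpowr:
  assumes "1 \<le> p" and [measurable]: "g \<in> borel_measurable M"
  shows "ennpowr (\<integral>\<^sup>+x. g x \<partial>M) p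
    \<le> ennpowr (emeasure M (space M)) (p - 1) * (\<integral>\<^sup>+x. ennpowr (g x) p \<partial>M)"
proof (cases "p = 1")
  case False
  then have p: "p > 1" using assms by simp
  let ?q = "p / (p - 1)"
  have "(\<integral>\<^sup>+x. g x * 1 \<partial>M)
    \<le> ennpowr (\<integral>\<^sup>+x. ennpowr (g x) p \<partial>M) (1 / p) * ennpowr (\<integral>\<^sup>+x. ennpowr 1 ?q \<partial>M) (1 / ?q)"
    using p by (intro Hoelder_nn_integral) (auto simp: field_simps)
  then have "ennpowr (\<integral>\<^sup>+x. g x \<partial>M) p
      \<le> ennpowr (ennpowr (\<integral>\<^sup>+x. ennpowr (g x) p \<partial>M) (1 / p) * ennpowr (emeasure M (space M)) (1 / ?q)) p"
    using p by (intro ennpowr_mono) auto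
  also have "\<dots> = (\<integral>\<^sup>+x. ennpowr (g x) p \<partial>M) * ennpowr (emeasure M (space M)) (p - 1)"
    using p by (simp add: ennpowr_mult ennpowr_ennpowr)
  finally show ?thesis by (simp add: mult.commute)
qed simp

text \<open>
  Minkowski's integral inequality, with an upper bound \<open>m y\<close> for the norm of \<open>G (\<cdot>, y)\<close> given
  in advance: by Jensen's inequality for the measure \<open>k(y) m(y) dy\<close>, the power
  \<open>(\<integral> k G)\<^sup>p = (\<integral> (G / m) k m)\<^sup>p\<close> is at most
  \<open>(\<integral> k m)\<^sup>p\<^sup>-\<^sup>1 \<integral> (G / m)\<^sup>p k m\<close>, and the latter may be integrated under the integral sign.
\<close>
lemma Minkowski_nn_integral:
  assumes "sigma_finite_measure M" "sigma_finite_measure N" and p: "1 \<le> p"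
  assumes G [measurable]: "case_prod G \<in> borel_measurable (M \<Otimes>\<^sub>M N)"
    and k [measurable]: "k \<in> borel_measurable N" and m [measurable]: "m \<in> borel_measurable N"
  assumes bound: "AE y in N. k y \<noteq> 0 \<longrightarrow> m y \<noteq> 0 \<and>
      (m y \<noteq> top \<longrightarrow> (\<integral>\<^sup>+x. ennpowr (G x y) p \<partial>M) \<le> D * ennpowr (m y) p)"
  assumes fin: "(\<integral>\<^sup>+y. k y * m y \<partial>N) \<noteq> top"
  shows "(\<integral>\<^sup>+x. ennpowr (\<integral>\<^sup>+y. k y * G x y \<partial>N) p \<partial>M) \<le> D * ennpowr (\<integral>\<^sup>+y. k y * m y \<partial>N) p"
proof -
  interpret M: sigma_finite_measure M by fact
  interpret N: sigma_finite_measure N by fact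
  interpret pair_sigma_finite M N ..
  define I where "I = (\<integral>\<^sup>+y. k y * m y \<partial>N)"
  have good: "AE y in N. k y \<noteq> 0 \<longrightarrow> m y \<noteq> 0 \<and> m y \<noteq> top \<and>
      (\<integral>\<^sup>+x. ennpowr (G x y) p \<partial>M) \<le> D * ennpowr (m y) p"
  proof -
    have "AE y in N. k y * m y \<noteq> top"
      using nn_integral_PInf_AE[of "\<lambda>y. k y * m y" N] fin by auto
    with bound show ?thesis
      by eventually_elim (auto simp: ennreal_mult_top)
  qed
  have jensen: "ennpowr (\<integral>\<^sup>+y. k y * G x y \<partial>N) p
      \<le> ennpowr I (p - 1) * (\<integral>\<^sup>+y. k y * m y * ennpowr (inverse (m y) * G x y) p \<partial>N)"
    if x: "x \<in> space M" for x
  proof -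
    have [measurable]: "G x \<in> borel_measurable N"
      using measurable_compose[OF measurable_Pair1'[OF x] G] by simp
    have "(\<integral>\<^sup>+y. k y * G x y \<partial>N) = (\<integral>\<^sup>+y. k y * m y * (inverse (m y) * G x y) \<partial>N)"
    proof (rule nn_integral_cong_AE, use good in eventually_elim)
      case (elim y)
      show ?case
      proof (cases "k y = 0")
        case False
        with elim have "m y * inverse (m y) = 1"
          by (simp add: less_top mult.commute[of "m y"] flip: divide_ennreal_def)
        then show ?thesis
          by (metis mult.assoc mult.right_neutral)
      qed simp
    qed
    also have "\<dots> = (\<integral>\<^sup>+y. inverse (m y) * G x y \<partial>density N (\<lambda>y. k y * m y))"
      by (subst nn_integral_density) auto
    also have "ennpowr \<dots> p \<le> ennpowr (emeasure (density N (\<lambda>y. k y * m y)) (space N)) (p - 1)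
        * (\<integral>\<^sup>+y. ennpowr (inverse (m y) * G x y) p \<partial>density N (\<lambda>y. k y * m y))"
      using Jensen_ennpowr[of p "\<lambda>y. inverse (m y) * G x y" "density N (\<lambda>y. k y * m y)"] p by simp
    also have "emeasure (density N (\<lambda>y. k y * m y)) (space N) = I"
      by (simp add: emeasure_density I_def cong: nn_integral_cong)
    also have "(\<integral>\<^sup>+y. ennpowr (inverse (m y) * G x y) p \<partial>density N (\<lambda>y. k y * m y))
        = (\<integral>\<^sup>+y. k y * m y * ennpowr (inverse (m y) * G x y) p \<partial>N)"
      by (subst nn_integral_density) auto
    finally show ?thesis .
  qed
  have "(\<integral>\<^sup>+x. ennpowr (\<integral>\<^sup>+y. k y * G x y \<partial>N) p \<partial>M)
      \<le> (\<integral>\<^sup>+x. ennpowr I (p - 1) * (\<integral>\<^sup>+y. k y * m y * ennpowr (inverse (m y) * G x y) p \<partial>N) \<partial>M)"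
    by (intro nn_integral_mono jensen)
  also have "\<dots> = ennpowr I (p - 1) * (\<integral>\<^sup>+x. (\<integral>\<^sup>+y. k y * m y * ennpowr (inverse (m y) * G x y) p \<partial>N) \<partial>M)"
    by (rule nn_integral_cmult) measurable
  also have "(\<integral>\<^sup>+x. (\<integral>\<^sup>+y. k y * m y * ennpowr (inverse (m y) * G x y) p \<partial>N) \<partial>M)
      = (\<integral>\<^sup>+y. (\<integral>\<^sup>+x. k y * m y * ennpowr (inverse (m y) * G x y) p \<partial>M) \<partial>N)"
    by (rule Fubini'[symmetric]) measurable
  also have "\<dots> \<le> (\<integral>\<^sup>+y. D * (k y * m y) \<partial>N)"
  proof (rule nn_integral_mono_AE, use good AE_space in eventually_elim)
    case (elim y)
    have [measurable]: "(\<lambda>x. G x y) \<in> borel_measurable M"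
      using measurable_compose[OF measurable_Pair2'[OF elim(2)] G] by simp
    show ?case
    proof (cases "k y = 0")
      case False
      have "(\<integral>\<^sup>+x. k y * m y * ennpowr (inverse (m y) * G x y) p \<partial>M)
          = k y * m y * (ennpowr (inverse (m y)) p * (\<integral>\<^sup>+x. ennpowr (G x y) p \<partial>M))"
        using p by (simp add: ennpowr_mult nn_integral_cmult)
      also have "\<dots> \<le> k y * m y * (ennpowr (inverse (m y)) p * (D * ennpowr (m y) p))"
        using False elim by (intro mult_left_mono) auto
      also have "\<dots> = (D * (k y * m y)) * ennpowr (inverse (m y) * m y) p"
        using p by (simp add: ennpowr_mult mult_ac)
      also have "inverse (m y) * m y = 1"
        using elim False by (simp add: less_top mult.commute[of _ "m y"] flip: divide_ennreal_def)
      finally show ?thesis by simp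
    qed simp
  qed
  also have "\<dots> = D * I"
    by (simp add: nn_integral_cmult I_def)
  also have "ennpowr I (p - 1) * (D * I) = D * ennpowr I p"
    using ennpowr_add[of "p - 1" 1 I] p by (simp add: mult_ac)
  finally show ?thesis
    by (simp add: I_def mult_left_mono)
qed

section \<open>Linear changes of variables\<close>

text \<open>
  Lebesgue measure is determined by its values on boxes, so a linear bijection that scales
  the volume of boxes by \<open>c\<close> scales Lebesgue measure by \<open>c\<close>.
\<close>
lemma nn_integral_linear_bij:
  fixes h :: "'a::euclidean_space \<Rightarrow> 'a"
  assumes lin: "linear h" and bij: "bij h" and c: "0 < c"
    and box: "\<And>a b. measure lebesgue (h ` cbox a b) = c * measure lebesgue (cbox a b)"
    and g [measurable]: "g \<in> borel_measurable borel"
  shows "ennreal c * (\<integral>\<^sup>+x. g (h x) \<partial>lborel) = (\<integral>\<^sup>+x. g x \<partial>lborel)"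
proof -
  have cont: "continuous_on UNIV h"
    by (simp add: lin linear_continuous_on linear_linear)
  have [measurable]: "h \<in> borel_measurable borel"
    by (rule borel_measurable_continuous_onI[OF cont])
  have "lborel = density (distr lborel borel h) (\<lambda>_. ennreal c)"
  proof (rule lborel_eqI)
    fix l u :: 'a assume le: "\<And>b. b \<in> Basis \<Longrightarrow> l \<bullet> b \<le> u \<bullet> b"
    let ?S = "h -` box l u"
    have "?S = inv h ` box l u"
      using bij by (simp add: bij_vimage_eq_inv_image)
    moreover have "linear (inv h)"
      using bij lin by (simp add: bij_betw_def inj_linear_imp_inv_linear)
    ultimately have "bounded ?S"
      by (simp add: bounded_linear_image linear_linear)
    moreover have op: "open ?S"
      by (intro open_vimage open_box cont)
    ultimately have S: "?S \<in> lmeasurable"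
      by (rule lmeasurable_open)
    have "h ` ?S = box l u"
      using bij by (simp add: bij_is_surj surj_image_vimage_eq)
    with measure_linear_sufficient[OF lin S box]
    have "c * measure lebesgue ?S = measure lebesgue (box l u)"
      by simp
    then have "ennreal c * emeasure lebesgue ?S = emeasure lebesgue (box l u)"
      using S c by (simp add: emeasure_eq_measure2 flip: ennreal_mult)
    then show "emeasure (density (distr lborel borel h) (\<lambda>_. ennreal c)) (box l u)
        = (\<Prod>b\<in>Basis. (u - l) \<bullet> b)"
      using le op by (simp add: emeasure_density emeasure_distr nn_integral_cmult emeasure_lborel_box_eq inner_diff_left)
  qed simp
  then have "(\<integral>\<^sup>+x. g x \<partial>lborel) = (\<integral>\<^sup>+x. g x \<partial>density (distr lborel borel h) (\<lambda>_. ennreal c))"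
    by simp
  also have "\<dots> = ennreal c * (\<integral>\<^sup>+x. g (h x) \<partial>lborel)"
    by (simp add: nn_integral_density nn_integral_distr nn_integral_cmult)
  finally show ?thesis ..
qed

text \<open>
  A translation along the \<open>n\<close>-th axis moves the box to one whose \<open>n\<close>-th coordinate starts at
  \<open>0\<close>, where the claim is the fact \<open>measure_shear_interval\<close>.  The shear turns
  the translation into another translation.
\<close>
lemma measure_shear_cbox:
  fixes a b :: "real^'k"
  assumes "m \<noteq> n"
  shows "measure lebesgue ((\<lambda>x. \<chi> i. if i = m then x $ m + x $ n else x $ i) ` cbox a b)
    = measure lebesgue (cbox a b)"
proof (cases "cbox a b = {}")
  case False
  let ?h = "\<lambda>x::real^'k. \<chi> i. if i = m then x $ m + x $ n else x $ i"
  let ?v = "\<chi> i. if i = n then - a $ n else 0"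
  have "?h ` cbox (?v + a) (?v + b) = (+) (?h ?v) ` ?h ` cbox a b"
    unfolding cbox_translation image_image
    by (intro image_cong) (auto simp: vec_eq_iff)
  then have "measure lebesgue (?h ` cbox a b) = measure lebesgue (?h ` cbox (?v + a) (?v + b))"
    by (simp add: measure_translation)
  also have "\<dots> = measure lebesgue (cbox (?v + a) (?v + b))"
    using assms False by (intro measure_shear_interval) (auto simp: cbox_translation)
  also have "\<dots> = measure lebesgue (cbox a b)"
    unfolding cbox_translation by (rule measure_translation)
  finally show ?thesis .
qed simp

text \<open>
  The formula is multiplicative in \<open>A\<close>, so that it suffices to prove it for diagonal
  matrices, transpositions and shears.
\<close>
lemma nn_integral_matrix_vector:
  fixes A :: "real^'k^'k"
  assumes "det A \<noteq> 0" and "g \<in> borel_measurable borel"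
  shows "ennreal \<bar>det A\<bar> * (\<integral>\<^sup>+x. g (A *v x) \<partial>lborel) = (\<integral>\<^sup>+x. g x \<partial>lborel)"
proof -
  let ?P = "\<lambda>A::real^'k^'k. det A \<noteq> 0 \<longrightarrow> (\<forall>g\<in>borel_measurable borel.
      ennreal \<bar>det A\<bar> * (\<integral>\<^sup>+x. g (A *v x) \<partial>lborel) = (\<integral>\<^sup>+x. g x \<partial>lborel))"
  have cont: "(*v) A \<in> borel_measurable borel" for A :: "real^'k^'k"
    by (intro borel_measurable_continuous_onI linear_continuous_on)
       (simp add: matrix_vector_mul_bounded_linear)
  have box: "?P A"
    if "\<And>a b. measure lebesgue ((*v) A ` cbox a b) = \<bar>det A\<bar> * measure lebesgue (cbox a b)" for A :: "real^'k^'k"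
  proof (intro impI ballI)
    fix g :: "real^'k \<Rightarrow> ennreal" assume "det A \<noteq> 0" "g \<in> borel_measurable borel"
    then show "ennreal \<bar>det A\<bar> * (\<integral>\<^sup>+x. g (A *v x) \<partial>lborel) = (\<integral>\<^sup>+x. g x \<partial>lborel)"
      by (intro nn_integral_linear_bij that)
         (simp_all add: invertible_eq_bij[symmetric] invertible_det_nz)
  qed
  have "?P A"
  proof (induction A rule: induct_matrix_elementary_alt)
    case (1 A B)
    show ?case
    proof (intro impI ballI)
      fix g :: "real^'k \<Rightarrow> ennreal"
      assume AB: "det (A ** B) \<noteq> 0" and [measurable]: "g \<in> borel_measurable borel"
      have gA: "(\<lambda>x. g (A *v x)) \<in> borel_measurable borel"
        using measurable_compose[OF cont[of A], of g borel] by simp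
      have "ennreal \<bar>det (A ** B)\<bar> * (\<integral>\<^sup>+x. g ((A ** B) *v x) \<partial>lborel)
          = ennreal \<bar>det A\<bar> * (ennreal \<bar>det B\<bar> * (\<integral>\<^sup>+x. g (A *v (B *v x)) \<partial>lborel))"
        by (simp add: det_mul abs_mult ennreal_mult mult.assoc matrix_vector_mul_assoc)
      also have "\<dots> = ennreal \<bar>det A\<bar> * (\<integral>\<^sup>+x. g (A *v x) \<partial>lborel)"
        using AB 1(2)[THEN mp, THEN bspec, OF _ gA] by (simp add: det_mul)
      also have "\<dots> = (\<integral>\<^sup>+x. g x \<partial>lborel)"
        using AB 1(1) by (auto simp: det_mul)
      finally show "ennreal \<bar>det (A ** B)\<bar> * (\<integral>\<^sup>+x. g ((A ** B) *v x) \<partial>lborel) = (\<integral>\<^sup>+x. g x \<partial>lborel)" .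
    qed
  next
    case (2 A i)
    then show ?case by (simp add: det_zero_row)
  next
    case (3 A)
    have "(A *v x) $ i = A $ i $ i * x $ i" for x i
    proof -
      have "(\<Sum>j\<in>UNIV. A $ i $ j * x $ j) = (\<Sum>j\<in>UNIV. if j = i then A $ i $ i * x $ i else 0)"
        using 3 by (intro sum.cong) auto
      then show ?thesis by (simp add: matrix_vector_mult_def)
    qed
    then have "(*v) A = (\<lambda>x. \<chi> i. A $ i $ i * x $ i)"
      by (auto simp: vec_eq_iff)
    then show ?case
      using measure_stretch[OF lmeasurable_cbox, of "\<lambda>i. A $ i $ i"] 3
      by (intro box) (simp add: det_diagonal)
  next
    case (4 m n)
    let ?A = "(\<chi> i j. mat 1 $ i $ Transposition.transpose m n j) :: real^'k^'k"
    have A: "(*v) ?A = (\<lambda>x. \<chi> i. x $ Transposition.transpose m n i)"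
    proof (intro ext)
      fix x :: "real^'k"
      have "(\<Sum>j\<in>UNIV. (if i = Transposition.transpose m n j then 1 else 0) * x $ j)
          = (\<Sum>j\<in>UNIV. if j = Transposition.transpose m n i then x $ j else 0)" for i
        by (intro sum.cong) (auto simp: transpose_eq_iff)
      then show "?A *v x = (\<chi> i. x $ Transposition.transpose m n i)"
        by (simp add: vec_eq_iff matrix_vector_mult_def mat_def)
    qed
    have d: "\<bar>det ?A\<bar> = 1"
      by (simp add: det_permute_columns permutes_swap_id sign_swap_id abs_mult)
    have "measure lebesgue ((*v) ?A ` cbox a b) = measure lebesgue (cbox a b)" for a b
    proof (cases "cbox a b = {}")
      case False
      let ?t = "\<lambda>x::real^'k. \<chi> i. x $ Transposition.transpose m n i"
      have eq: "?t ` cbox a b = cbox (?t a) (?t b)"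
        by (auto simp: image_iff lambda_swap_Galois mem_box_cart) (metis transpose_involutory)+
      with False have "cbox (?t a) (?t b) \<noteq> {}"
        by blast
      with False show ?thesis
        using prod.permute[OF permutes_swap_id, where S=UNIV and g="\<lambda>i. (b - a) $ i", symmetric]
        by (simp add: A eq content_cbox_cart)
    qed simp
    then show ?case
      by (intro box) (simp add: d)
  next
    case (5 m n)
    let ?A = "(\<chi> i j. of_bool (i = m \<and> j = n \<or> i = j)) :: real^'k^'k"
    have "(*v) ?A = (\<lambda>x. \<chi> i. if i = m then x $ m + x $ n else x $ i)"
    proof (intro ext)
      fix x :: "real^'k"
      have "(\<Sum>j\<in>UNIV. of_bool (i = m \<and> j = n \<or> i = j) * x $ j)
          = (\<Sum>j\<in>UNIV. (if j = n \<and> i = m then x $ n else 0) + (if j = i then x $ i else 0))" for i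
        using 5 by (intro sum.cong) auto
      then show "?A *v x = (\<chi> i. if i = m then x $ m + x $ n else x $ i)"
        by (auto simp: vec_eq_iff matrix_vector_mult_def sum.distrib)
    qed
    moreover have "det ?A = 1"
    proof -
      have "?A = (\<chi> k. if k = m then row m (mat 1) + 1 *s row n (mat 1) else row k (mat 1))"
        using 5 by (auto simp: vec_eq_iff row_def mat_def)
      then show ?thesis
        using det_row_operation[OF 5, of "mat 1" 1] by simp
    qed
    ultimately show ?case
      using measure_shear_cbox[OF 5] by (intro box) simp
  qed
  then show ?thesis using assms by blast
qed

section \<open>Homogeneous balls\<close>

lemma hnorm_nonneg [simp]: "0 \<le> hnorm x"
  by (simp add: hnorm_def)

lemma hnorm_power4: "hnorm x ^ 4 = (\<Sum>i\<in>UNIV. (x $ Some i)\<^sup>2)\<^sup>2 + (x $ None)\<^sup>2"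
  by (simp add: hnorm_def)

lemma hnorm_eq_0_iff [simp]: "hnorm x = 0 \<longleftrightarrow> x = 0"
proof
  assume "hnorm x = 0"
  then have "(\<Sum>i\<in>UNIV. (x $ Some i)\<^sup>2)\<^sup>2 + (x $ None)\<^sup>2 = 0"
    by (simp flip: hnorm_power4)
  then have "x $ None = 0" "x $ Some i = 0" for i
    by (auto simp: add_nonneg_eq_0_iff sum_nonneg_eq_0_iff)
  then have "x $ k = 0" for k
    by (cases k) auto
  then show "x = 0" by (simp add: vec_eq_iff)
qed (simp add: hnorm_def)

lemma hnorm_zero [simp]: "hnorm 0 = 0"
  by simp

lemma continuous_on_hnorm [continuous_intros]:
  "continuous_on A f \<Longrightarrow> continuous_on A (\<lambda>x. hnorm (f x))"
  unfolding hnorm_def by (intro continuous_intros)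

lemma borel_measurable_hnorm [measurable]: "hnorm \<in> borel_measurable borel"
  by (intro borel_measurable_continuous_onI continuous_intros)

lemma hball_zero: "hball 0 r = {y. hnorm y < r}"
  by (simp add: hball_def hdist_def hmult_def hinv_def hnorm_def option.case_eq_if)

lemma hball_zero_mono: "r \<le> s \<Longrightarrow> hball 0 r \<subseteq> hball 0 s"
  by (auto simp: hball_zero)

lemma open_hball_zero: "open (hball 0 r)"
  unfolding hball_zero by (intro open_Collect_less continuous_intros)

lemma hball_zero_borel [measurable]: "hball 0 r \<in> sets borel"
  by (intro borel_open open_hball_zero)

lemma hball_zero_lebesgue [measurable]: "hball 0 r \<in> sets lebesgue"
  by (intro sets_completionI_sets) simp

lemma norm_le_hnorm: "(norm x)\<^sup>2 \<le> (hnorm x)\<^sup>2 + hnorm x ^ 4"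
proof -
  have "(norm x)\<^sup>2 = (\<Sum>i\<in>UNIV. (x $ i)\<^sup>2)"
    by (simp add: norm_vec_def L2_set_def sum_nonneg)
  also have "\<dots> = (x $ None)\<^sup>2 + (\<Sum>i\<in>UNIV. (x $ Some i)\<^sup>2)"
    by (simp add: UNIV_option_conv sum.reindex)
  also have "(\<Sum>i\<in>UNIV. (x $ Some i)\<^sup>2) \<le> (hnorm x)\<^sup>2"
    by (rule power2_le_imp_le) (simp_all add: hnorm_power4)
  also have "(x $ None)\<^sup>2 \<le> hnorm x ^ 4"
    by (simp add: hnorm_power4)
  finally show ?thesis by simp
qed

lemma bounded_hball_zero: "bounded (hball 0 r)"
proof (rule boundedI)
  fix x assume "x \<in> hball 0 r"
  then have "hnorm x \<le> r" by (simp add: hball_zero)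
  then have "(hnorm x)\<^sup>2 + hnorm x ^ 4 \<le> r\<^sup>2 + r ^ 4"
    by (intro add_mono power_mono) auto
  with norm_le_hnorm[of x] show "norm x \<le> sqrt (r\<^sup>2 + r ^ 4)"
    by (intro real_le_rsqrt) linarith
qed

lemma compact_subset_hball_zero:
  assumes "compact K"
  obtains r where "0 < r" "K \<subseteq> hball 0 r"
proof -
  have "compact (hnorm ` K)"
    by (intro compact_continuous_image continuous_intros assms)
  then obtain b where "\<forall>x\<in>K. \<bar>hnorm x\<bar> \<le> b"
    using compact_imp_bounded[of "hnorm ` K"] by (auto simp: bounded_iff)
  then have "K \<subseteq> hball 0 (max b 0 + 1)"
    by (auto simp: hball_zero)
  then show ?thesis
    by (intro that[of "max b 0 + 1"]) auto
qed

text \<open>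
  The dilations to which the norm is adapted.  The square in the last coordinate makes the
  determinant \<open>r\<^sup>2\<^sup>n\<^sup>+\<^sup>2 = r\<^sup>Q\<close>, whence the volume of balls.
\<close>
definition hdil :: "real \<Rightarrow> 'n::finite heis_matrix" where
  "hdil r = (\<chi> i j. if i = j then (case i of Some _ \<Rightarrow> r | None \<Rightarrow> r\<^sup>2) else 0)"

lemma hdil_component: "(hdil r *v x) $ i = (case i of Some _ \<Rightarrow> r | None \<Rightarrow> r\<^sup>2) * x $ i"
proof -
  have "(\<Sum>j\<in>UNIV. (if i = j then (case i of Some _ \<Rightarrow> r | None \<Rightarrow> r\<^sup>2) else 0) * x $ j)
    = (\<Sum>j\<in>UNIV. if j = i then (case i of Some _ \<Rightarrow> r | None \<Rightarrow> r\<^sup>2) * x $ i else 0)"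
    by (intro sum.cong) auto
  then show ?thesis
    by (simp add: hdil_def matrix_vector_mult_def)
qed

lemma hnorm_hdil:
  assumes "0 \<le> r"
  shows "hnorm (hdil r *v x) = r * hnorm x"
proof -
  have "hnorm (hdil r *v x) ^ 4 = (r * hnorm x) ^ 4"
    unfolding power_mult_distrib hnorm_power4
    by (simp add: hdil_component power_mult_distrib distrib_left flip: sum_distrib_left power_mult)
  then show ?thesis
    using assms by (subst (asm) power_eq_iff_eq_base) auto
qed

lemma det_hdil: "det (hdil r :: 'n::finite heis_matrix) = r ^ hdim TYPE('n)"
proof -
  have "det (hdil r :: 'n heis_matrix)
      = (\<Prod>i\<in>(UNIV :: ('n + 'n) option set). case i of Some _ \<Rightarrow> r | None \<Rightarrow> r\<^sup>2)"
    by (subst det_diagonal) (auto simp: hdil_def)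
  also have "\<dots> = r ^ hdim TYPE('n)"
    by (simp add: UNIV_option_conv prod.reindex hdim_def mult_2 flip: power_add)
  finally show ?thesis .
qed

lemma emeasure_hball_zero_finite: "emeasure lebesgue (hball 0 r) \<noteq> top"
proof -
  have "hball 0 r \<in> lmeasurable"
    by (rule lmeasurable_open[OF bounded_hball_zero open_hball_zero])
  then show ?thesis
    by (auto dest: fmeasurableD2 simp del: emeasure_completion)
qed

lemma emeasure_hball_zero:
  assumes "0 < r"
  shows "emeasure lebesgue (hball 0 r :: 'n::finite heis set)
    = ennreal (r ^ hdim TYPE('n)) * emeasure lebesgue (hball 0 1 :: 'n heis set)"
proof -
  have "emeasure lebesgue (hball 0 r :: 'n heis set) = (\<integral>\<^sup>+x. indicator (hball 0 r :: 'n heis set) x \<partial>lborel)"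
    by simp
  also have "\<dots> = ennreal (r ^ hdim TYPE('n)) * (\<integral>\<^sup>+x. indicator (hball 0 r) (hdil r *v x :: 'n heis) \<partial>lborel)"
    using nn_integral_matrix_vector[of "hdil r :: 'n heis_matrix" "indicator (hball 0 r)"] assms
    by (simp add: det_hdil)
  also have "(\<lambda>x. indicator (hball 0 r) (hdil r *v x :: 'n heis)) = (indicator (hball 0 1) :: 'n heis \<Rightarrow> ennreal)"
    using assms by (auto simp: fun_eq_iff indicator_def hball_zero hnorm_hdil)
  finally show ?thesis
    by simp
qed

lemma emeasure_hball_zero_pos:
  assumes "0 < r"
  shows "emeasure lebesgue (hball 0 r :: 'n::finite heis set) \<noteq> 0"
proof -
  have "(0 :: 'n heis) \<in> hball 0 r"
    using assms by (simp add: hball_zero)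
  then have "\<not> negligible (hball 0 r :: 'n heis set)"
    by (intro open_not_negligible open_hball_zero) auto
  then show ?thesis
    by (auto simp: negligible_iff_null_sets null_sets_def)
qed

lemma average_indicator_hball:
  assumes "0 < r" "r \<le> s"
  shows "average (hball 0 s :: 'n::finite heis set) (indicator (hball 0 r)) = ennreal ((r / s) ^ hdim TYPE('n))"
proof -
  let ?Q = "hdim TYPE('n)" and ?v = "emeasure lebesgue (hball 0 1 :: 'n heis set)"
  have "(\<integral>\<^sup>+x\<in>(hball 0 s :: 'n heis set). indicator (hball 0 r) x \<partial>lebesgue)
      = (\<integral>\<^sup>+x. indicator (hball 0 r :: 'n heis set) x \<partial>lebesgue)"
    using assms hball_zero_mono[of r s] by (intro nn_integral_cong) (auto simp: indicator_def)
  then have "average (hball 0 s :: 'n heis set) (indicator (hball 0 r))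
      = emeasure lebesgue (hball 0 r :: 'n heis set) / emeasure lebesgue (hball 0 s :: 'n heis set)"
    by (simp add: average_def)
  also have "\<dots> = (ennreal (r ^ ?Q) * ?v) / (ennreal (s ^ ?Q) * ?v)"
    using emeasure_hball_zero[OF assms(1), where 'n = 'n] emeasure_hball_zero[of s, where 'n = 'n] assms
    by simp
  also have "\<dots> = ennreal (r ^ ?Q) / ennreal (s ^ ?Q)"
    by (intro divide_mult_eq) (simp_all add: emeasure_hball_zero_pos emeasure_hball_zero_finite del: emeasure_completion)
  finally show ?thesis
    using assms by (simp add: divide_ennreal power_divide)
qed

text \<open>
  As a supremum of continuous functions of \<open>M\<close>, the operator norm is lower semicontinuous.
\<close>
lemma borel_measurable_hopnorm [measurable]:
  "(hopnorm :: 'n::finite heis_matrix \<Rightarrow> ennreal) \<in> borel_measurable borel"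
proof (rule borel_measurableI_greater)
  fix c
  have "{M :: 'n heis_matrix. c < hopnorm M} = (\<Union>x\<in>{x. x \<noteq> 0}. {M. c < ennreal (hnorm (M *v x) / hnorm x)})"
    by (auto simp: hopnorm_def less_SUP_iff)
  moreover have "open {M. c < ennreal (hnorm (M *v x) / hnorm x)}" if "x \<noteq> 0" for x :: "'n heis"
    using that
    by (intro open_Collect_less continuous_intros continuous_on_ennreal)
       (auto simp: matrix_vector_mult_def intro!: continuous_intros)
  ultimately have "open {M :: 'n heis_matrix. c < hopnorm M}"
    by auto
  then show "{M :: 'n heis_matrix \<in> space borel. c < hopnorm M} \<in> sets borel"
    by simp
qed

lemma hnorm_matrix_le:
  assumes "hopnorm M = ennreal m" "0 \<le> m"
  shows "hnorm (M *v x) \<le> m * hnorm x"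
proof (cases "x = 0")
  case False
  then have "ennreal (hnorm (M *v x) / hnorm x) \<le> ennreal m"
    unfolding assms(1)[symmetric] hopnorm_def by (intro SUP_upper) auto
  moreover have "0 < hnorm x"
    using False by (simp add: less_le)
  ultimately show ?thesis
    using assms by (simp add: divide_le_eq)
qed simp

lemma hopnorm_pos:
  assumes "det M \<noteq> 0"
  shows "hopnorm M \<noteq> 0"
proof
  assume "hopnorm M = 0"
  then have "hnorm (M *v x) \<le> 0" for x
    using hnorm_matrix_le[of M 0] by simp
  then have "M *v 1 = 0"
    by (metis hnorm_eq_0_iff hnorm_nonneg order_antisym)
  with assms have "(1 :: 'a heis) = 0"
    by (metis invertible_det_nz matrix_left_invertible_ker invertible_left_inverse)
  then show False by (simp add: vec_eq_iff)
qed

section \<open>Muckenhoupt and reverse Hoelder weights\<close>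

lemma Hoelder_set_nn_integral:
  assumes pq: "p > 1" "q > 1" "1 / p + 1 / q = 1" and E: "E \<in> sets M"
    and "f \<in> borel_measurable M" "g \<in> borel_measurable M"
  shows "(\<integral>\<^sup>+x\<in>E. f x * g x \<partial>M)
    \<le> ennpowr (\<integral>\<^sup>+x\<in>E. ennpowr (f x) p \<partial>M) (1 / p) * ennpowr (\<integral>\<^sup>+x\<in>E. ennpowr (g x) q \<partial>M) (1 / q)"
  using Hoelder_nn_integral[OF pq, of f "restrict_space M E" g] assms
  by (simp add: nn_integral_restrict_space measurable_restrict_space1)

lemma Jensen_average:
  assumes p: "1 \<le> p" and E: "E \<in> sets lebesgue" "emeasure lebesgue E \<noteq> 0" "emeasure lebesgue E \<noteq> top"
    and g: "g \<in> borel_measurable lebesgue"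
  shows "ennpowr (average E g) p \<le> average E (\<lambda>x. ennpowr (g x) p)"
proof -
  define V where "V = emeasure lebesgue E"
  have V: "V \<noteq> 0" "V \<noteq> top"
    using E by (simp_all add: V_def del: emeasure_completion)
  have "emeasure (restrict_space lebesgue E) (space (restrict_space lebesgue E)) = V"
    using E by (simp add: emeasure_restrict_space space_restrict_space V_def del: emeasure_completion)
  with Jensen_ennpowr[OF p, of g "restrict_space lebesgue E"] g E
  have "ennpowr (\<integral>\<^sup>+x\<in>E. g x \<partial>lebesgue) p \<le> ennpowr V (p - 1) * (\<integral>\<^sup>+x\<in>E. ennpowr (g x) p \<partial>lebesgue)"
    by (simp add: nn_integral_restrict_space measurable_restrict_space1)
  then have "ennpowr (inverse V) p * ennpowr (\<integral>\<^sup>+x\<in>E. g x \<partial>lebesgue) p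
      \<le> ennpowr (inverse V) p * (ennpowr V (p - 1) * (\<integral>\<^sup>+x\<in>E. ennpowr (g x) p \<partial>lebesgue))"
    by (rule mult_left_mono) simp
  also have "ennpowr (inverse V) p = inverse V * ennpowr (inverse V) (p - 1)"
    using ennpowr_add[of 1 "p - 1" "inverse V"] p by simp
  also have "\<dots> * (ennpowr V (p - 1) * (\<integral>\<^sup>+x\<in>E. ennpowr (g x) p \<partial>lebesgue))
      = inverse V * ennpowr (inverse V * V) (p - 1) * (\<integral>\<^sup>+x\<in>E. ennpowr (g x) p \<partial>lebesgue)"
    using p by (simp add: ennpowr_mult mult_ac)
  also have "inverse V * V = 1"
    using V by (simp add: less_top mult.commute[of _ V] flip: divide_ennreal_def)
  finally show ?thesis
    using p by (simp add: average_def V_def[symmetric] divide_ennreal_def ennpowr_mult mult_ac)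
       (simp add: ennpowr_add[of 1 "p - 1" "inverse V", simplified] mult_ac)
qed

lemma locally_integrable_measurable:
  assumes "locally_integrable f"
  shows "f \<in> borel_measurable lebesgue"
proof (rule borel_measurable_LIMSEQ_metric)
  show "(\<lambda>x. indicator (cball 0 (real n)) x *\<^sub>R f x) \<in> borel_measurable lebesgue" for n
    using assms by (auto simp: locally_integrable_def set_integrable_def dest!: spec[of _ "cball 0 (real n)"])
  show "(\<lambda>n. indicator (cball 0 (real n)) x *\<^sub>R f x) \<longlonglongrightarrow> f x" for x
  proof (rule tendsto_eventually)
    obtain N :: nat where "norm x \<le> real N"
      using real_arch_simple by blast
    then show "\<forall>\<^sub>F n in sequentially. indicator (cball 0 (real n)) x *\<^sub>R f x = f x"
      by (intro eventually_sequentiallyI[of N]) auto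
  qed
qed

context
  fixes w :: "'n::finite heis \<Rightarrow> real"
  assumes w: "weight w"
begin

lemma weight_measurable [measurable]: "w \<in> borel_measurable lebesgue"
  using w by (auto simp: weight_def intro: locally_integrable_measurable)

lemma emeasure_weight_measure:
  "E \<in> sets lebesgue \<Longrightarrow> emeasure (weight_measure w) E = (\<integral>\<^sup>+x\<in>E. ennreal (w x) \<partial>lebesgue)"
  by (simp add: weight_measure_def emeasure_density)

lemma emeasure_weight_measure_hball_finite: "emeasure (weight_measure w) (hball 0 r) \<noteq> top"
proof -
  define K where "K = closure (hball 0 r :: 'n heis set)"
  have K: "compact K" "hball 0 r \<subseteq> K" "K \<in> sets lebesgue"
    using bounded_hball_zero closure_subset by (auto simp: K_def compact_closure)
  have "(\<integral>\<^sup>+x\<in>K. ennreal (w x) \<partial>lebesgue) < top"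
  proof -
    have "integrable lebesgue (\<lambda>x. indicator K x *\<^sub>R w x)"
      using w K by (auto simp: weight_def locally_integrable_def set_integrable_def)
    then have "(\<integral>\<^sup>+x. ennreal (norm (indicator K x *\<^sub>R w x)) \<partial>lebesgue) < \<infinity>"
      by (simp add: integrable_iff_bounded)
    also have "(\<integral>\<^sup>+x. ennreal (norm (indicator K x *\<^sub>R w x)) \<partial>lebesgue) = (\<integral>\<^sup>+x\<in>K. ennreal (w x) \<partial>lebesgue)"
      using w by (intro nn_integral_cong) (auto simp: indicator_def weight_def)
    finally show ?thesis by simp
  qed
  moreover have "emeasure (weight_measure w) (hball 0 r) \<le> emeasure (weight_measure w) K"
    using K by (intro emeasure_mono) (auto simp: weight_measure_def)
  ultimately show ?thesis
    using K by (auto simp: emeasure_weight_measure top_unique)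
qed

end

text \<open>
  The essential infimum is a supremum of almost everywhere lower bounds \<open>c\<close>, and for each of
  them \<open>c g \<le> g h\<close> almost everywhere on \<open>E\<close>.
\<close>
lemma ess_inf_mult_nn_integral_le:
  assumes [measurable]: "E \<in> sets lebesgue" "g \<in> borel_measurable lebesgue" "h \<in> borel_measurable lebesgue"
  shows "ess_inf E h * (\<integral>\<^sup>+x\<in>E. g x \<partial>lebesgue) \<le> (\<integral>\<^sup>+x\<in>E. g x * h x \<partial>lebesgue)"
proof -
  let ?S = "{c. AE x in lebesgue. x \<in> E \<longrightarrow> c \<le> h x}"
  have "ess_inf E h * (\<integral>\<^sup>+x\<in>E. g x \<partial>lebesgue) = (SUP c\<in>?S. c * (\<integral>\<^sup>+x\<in>E. g x \<partial>lebesgue))"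
    using SUP_mult_right_ennreal[of "\<lambda>c. c" ?S "\<integral>\<^sup>+x\<in>E. g x \<partial>lebesgue"] by (simp add: ess_inf_def)
  also have "\<dots> \<le> (\<integral>\<^sup>+x\<in>E. g x * h x \<partial>lebesgue)"
  proof (rule SUP_least)
    fix c assume c: "c \<in> ?S"
    have "c * (\<integral>\<^sup>+x\<in>E. g x \<partial>lebesgue) = (\<integral>\<^sup>+x. c * (g x * indicator E x) \<partial>lebesgue)"
      by (rule nn_integral_cmult[symmetric]) measurable
    also have "\<dots> \<le> (\<integral>\<^sup>+x\<in>E. g x * h x \<partial>lebesgue)"
    proof (rule nn_integral_mono_AE)
      from c have "AE x in lebesgue. x \<in> E \<longrightarrow> c \<le> h x"
        by simp
      then show "AE x in lebesgue. c * (g x * indicator E x) \<le> g x * h x * indicator E x"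
      proof eventually_elim
        case (elim x)
        then show ?case
          by (cases "x \<in> E") (auto simp: mult.commute[of c] intro: mult_left_mono)
      qed
    qed
    finally show "c * (\<integral>\<^sup>+x\<in>E. g x \<partial>lebesgue) \<le> (\<integral>\<^sup>+x\<in>E. g x * h x \<partial>lebesgue)" .
  qed
  finally show ?thesis .
qed

lemma Ap_weights_imp_weight: "w \<in> Ap_weights q \<Longrightarrow> weight w"
  by (auto simp: Ap_weights_def A1_weights_def split: if_splits)

text \<open>
  The form in which the Muckenhoupt condition is used: Lebesgue averages are controlled by
  weighted averages.  For \<open>q > 1\<close> this is Hoelder's inequality for \<open>g w\<^sup>1\<^sup>/\<^sup>q\<close> and
  \<open>w\<^sup>-\<^sup>1\<^sup>/\<^sup>q\<close>; for \<open>q = 1\<close> the weight is at least its essential infimum.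
\<close>
lemma Ap_average_le:
  fixes w :: "'n::finite heis \<Rightarrow> real"
  assumes wA: "w \<in> Ap_weights q" and q: "1 \<le> q"
  obtains C :: real where "0 < C"
    and "\<And>r g. 0 < r \<Longrightarrow> g \<in> borel_measurable lebesgue \<Longrightarrow>
      ennpowr (average (hball 0 r) g) q * emeasure (weight_measure w) (hball 0 r)
        \<le> ennreal C * (\<integral>\<^sup>+x\<in>hball 0 r. ennpowr (g x) q * ennreal (w x) \<partial>lebesgue)"
proof -
  have w: "weight w"
    using wA by (rule Ap_weights_imp_weight)
  note [measurable] = weight_measurable[OF w]
  have inv: "V * inverse V = 1" if "V = emeasure lebesgue (hball 0 r :: 'n heis set)" "0 < r" for V r
    using that emeasure_hball_zero_pos[of r, where 'n = 'n] emeasure_hball_zero_finite[of r, where 'a = 'n]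
    by (simp add: less_top del: emeasure_completion flip: divide_ennreal_def)
  show ?thesis
  proof (cases "q = 1")
    case True
    then obtain C where C: "\<And>x r. 0 < r \<Longrightarrow> average (hball x r) (\<lambda>y. ennreal (w y))
        \<le> ennreal C * ess_inf (hball x r) (\<lambda>y. ennreal (w y))"
      using wA by (auto simp: Ap_weights_def A1_weights_def)
    show ?thesis
    proof (rule that[of "max C 1"])
      fix r :: real and g :: "'n heis \<Rightarrow> ennreal"
      assume r: "0 < r" and [measurable]: "g \<in> borel_measurable lebesgue"
      let ?J = "\<integral>\<^sup>+x\<in>hball 0 r. g x \<partial>lebesgue"
      have "average (hball 0 r) g * emeasure (weight_measure w) (hball 0 r)
          = ?J * average (hball 0 r) (\<lambda>y. ennreal (w y))"
        by (simp add: average_def emeasure_weight_measure[OF w] divide_ennreal_def mult_ac)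
      also have "\<dots> \<le> ?J * (ennreal (max C 1) * ess_inf (hball 0 r) (\<lambda>y. ennreal (w y)))"
        using C[OF r, of 0]
        by (intro mult_left_mono) (auto elim!: order_trans intro!: mult_right_mono ennreal_leI)
      also have "\<dots> = ennreal (max C 1) * (ess_inf (hball 0 r) (\<lambda>y. ennreal (w y)) * ?J)"
        by (simp add: mult_ac)
      also have "\<dots> \<le> ennreal (max C 1) * (\<integral>\<^sup>+x\<in>hball 0 r. g x * ennreal (w x) \<partial>lebesgue)"
        by (intro mult_left_mono ess_inf_mult_nn_integral_le) auto
      finally show "ennpowr (average (hball 0 r) g) q * emeasure (weight_measure w) (hball 0 r)
          \<le> ennreal (max C 1) * (\<integral>\<^sup>+x\<in>hball 0 r. ennpowr (g x) q * ennreal (w x) \<partial>lebesgue)"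
        using True by simp
    qed simp
  next
    case False
    with q have q: "q > 1" by simp
    with wA obtain C where C: "\<And>x r. 0 < r \<Longrightarrow> average (hball x r) (\<lambda>y. ennreal (w y)) *
        ennpowr (average (hball x r) (\<lambda>y. ennpowr (ennreal (w y)) (- 1 / (q - 1)))) (q - 1) \<le> ennreal C"
      by (auto simp: Ap_weights_def)
    show ?thesis
    proof (rule that[of "max C 1"])
      fix r :: real and g :: "'n heis \<Rightarrow> ennreal"
      assume r: "0 < r" and [measurable]: "g \<in> borel_measurable lebesgue"
      define B V where "B = (hball 0 r :: 'n heis set)" and "V = emeasure lebesgue B"
      define W J N I where "W = emeasure (weight_measure w) B"
        and "J = (\<integral>\<^sup>+x\<in>B. g x \<partial>lebesgue)"
        and "N = (\<integral>\<^sup>+x\<in>B. ennpowr (ennreal (w x)) (- 1 / (q - 1)) \<partial>lebesgue)"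
        and "I = (\<integral>\<^sup>+x\<in>B. ennpowr (g x) q * ennreal (w x) \<partial>lebesgue)"
      have B [measurable]: "B \<in> sets lebesgue"
        by (simp add: B_def)
      have V: "V * inverse V = 1"
        using inv[OF _ r, of V] by (simp add: V_def B_def)
      have W: "W = (\<integral>\<^sup>+x\<in>B. ennreal (w x) \<partial>lebesgue)"
        by (simp add: W_def emeasure_weight_measure[OF w])
      have Cr: "W * inverse V * ennpowr (N * inverse V) (q - 1) \<le> ennreal (max C 1)"
        using C[OF r, of 0] unfolding average_def divide_ennreal_def
        by (auto simp: W N_def V_def B_def simp del: emeasure_completion elim!: order_trans intro!: ennreal_leI)
      have "ennpowr (J * inverse V) q * W \<le> ennreal (max C 1) * I"
      proof (cases "W = 0")
        case False
        \<comment> \<open>finiteness of \<open>N\<close> forces \<open>w > 0\<close> almost everywhere on the ball\<close>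
        have "N \<noteq> top"
        proof
          assume "N = top"
          moreover have "inverse V \<noteq> 0"
            using V by auto
          ultimately have "W * inverse V * ennpowr (N * inverse V) (q - 1) = top"
            using False q by (simp add: ennpowr_top_left ennreal_top_mult ennreal_mult_top)
          with Cr show False by (simp add: top_unique)
        qed
        then have "AE x in lebesgue. ennpowr (ennreal (w x)) (- 1 / (q - 1)) * indicator B x \<noteq> top"
          unfolding N_def using nn_integral_PInf_AE[of "\<lambda>x. ennpowr (ennreal (w x)) (- 1 / (q - 1)) * indicator B x" lebesgue]
          by simp
        then have "AE x in lebesgue. g x * indicator B x
            = (g x * ennpowr (ennreal (w x)) (1 / q)) * ennpowr (ennreal (w x)) (- 1 / q) * indicator B x"
        proof eventually_elim
          case (elim x)
          show ?case
          proof (cases "x \<in> B")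
            case True
            with elim q have "ennreal (w x) \<noteq> 0"
              by (auto simp: ennpowr_zero_left divide_less_0_iff)
            then have "ennpowr (ennreal (w x)) (1 / q) * ennpowr (ennreal (w x)) (- 1 / q) = 1"
              using ennpowr_add[of "1 / q" "- 1 / q" "ennreal (w x)"] by simp
            then show ?thesis
              by (simp add: mult.assoc)
          qed simp
        qed
        then have "J = (\<integral>\<^sup>+x\<in>B. (g x * ennpowr (ennreal (w x)) (1 / q)) * ennpowr (ennreal (w x)) (- 1 / q) \<partial>lebesgue)"
          unfolding J_def by (rule nn_integral_cong_AE)
        also have "\<dots> \<le> ennpowr (\<integral>\<^sup>+x\<in>B. ennpowr (g x * ennpowr (ennreal (w x)) (1 / q)) q \<partial>lebesgue) (1 / q)
            * ennpowr (\<integral>\<^sup>+x\<in>B. ennpowr (ennpowr (ennreal (w x)) (- 1 / q)) (q / (q - 1)) \<partial>lebesgue) (1 / (q / (q - 1)))"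
          using q by (intro Hoelder_set_nn_integral) (auto simp: field_simps)
        also have "\<dots> = ennpowr I (1 / q) * ennpowr N ((q - 1) / q)"
          using q by (simp add: ennpowr_mult ennpowr_ennpowr I_def N_def)
        finally have "ennpowr (J * inverse V) q \<le> ennpowr (ennpowr I (1 / q) * ennpowr N ((q - 1) / q) * inverse V) q"
          using q by (intro ennpowr_mono mult_right_mono) auto
        also have "\<dots> = I * (inverse V * ennpowr (N * inverse V) (q - 1))"
          using q ennpowr_add[of 1 "q - 1" "inverse V"]
          by (simp add: ennpowr_mult ennpowr_ennpowr mult_ac)
        finally have "ennpowr (J * inverse V) q * W \<le> I * (inverse V * ennpowr (N * inverse V) (q - 1)) * W"
          by (rule mult_right_mono) simp
        also have "\<dots> = (W * inverse V * ennpowr (N * inverse V) (q - 1)) * I"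
          by (simp add: mult_ac)
        also have "\<dots> \<le> ennreal (max C 1) * I"
          by (rule mult_right_mono[OF Cr]) simp
        finally show ?thesis .
      qed simp
      then show "ennpowr (average (hball 0 r) g) q * emeasure (weight_measure w) (hball 0 r)
          \<le> ennreal (max C 1) * (\<integral>\<^sup>+x\<in>hball 0 r. ennpowr (g x) q * ennreal (w x) \<partial>lebesgue)"
        by (simp add: average_def divide_ennreal_def J_def V_def W_def I_def B_def)
    qed simp
  qed
qed

lemma RH_weights_imp_weight: "w \<in> RH_weights r \<Longrightarrow> weight w"
  by (auto simp: RH_weights_def)

text \<open>
  Dually, the reverse Hoelder condition controls weighted integrals by Lebesgue averages:
  Hoelder's inequality separates \<open>h\<close> from \<open>w\<close>, and the condition bounds the factor with
  \<open>w\<close>.  The passage from the exponent \<open>t\<close> to a smaller exponent \<open>s\<close> is Jensen's inequality.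
\<close>
lemma RH_nn_integral_le:
  fixes w :: "'n::finite heis \<Rightarrow> real"
  assumes wR: "w \<in> RH_weights t" and s: "1 < s" "s \<le> t"
  obtains C :: real where "0 < C"
    and "\<And>r h. 0 < r \<Longrightarrow> h \<in> borel_measurable lebesgue \<Longrightarrow>
      (\<integral>\<^sup>+x\<in>hball 0 r. h x * ennreal (w x) \<partial>lebesgue)
        \<le> ennreal C * ennpowr (average (hball 0 r) (\<lambda>x. ennpowr (h x) (s / (s - 1)))) ((s - 1) / s)
          * emeasure (weight_measure w) (hball 0 r)"
proof -
  have w: "weight w"
    using wR by (rule RH_weights_imp_weight)
  note [measurable] = weight_measurable[OF w]
  obtain C where C: "\<And>x \<rho>. \<rho> > 0 \<Longrightarrow>
      ennpowr (average (hball x \<rho>) (\<lambda>y. ennpowr (ennreal (w y)) t)) (1 / t)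
        \<le> ennreal C * average (hball x \<rho>) (\<lambda>y. ennreal (w y))"
    using wR by (auto simp: RH_weights_def)
  show ?thesis
  proof (rule that[of "max C 1"])
    fix r :: real and h :: "'n heis \<Rightarrow> ennreal"
    assume r: "0 < r" and [measurable]: "h \<in> borel_measurable lebesgue"
    define B V where "B = (hball 0 r :: 'n heis set)" and "V = emeasure lebesgue B"
    define W where "W = emeasure (weight_measure w) B"
    define H where "H = average B (\<lambda>x. ennpowr (h x) (s / (s - 1)))"
    have B [measurable]: "B \<in> sets lebesgue"
      by (simp add: B_def)
    have V0: "V \<noteq> 0" "V \<noteq> top"
      using emeasure_hball_zero_pos[OF r, where 'n = 'n] emeasure_hball_zero_finite[of r, where 'a = 'n]
      by (simp_all add: V_def B_def del: emeasure_completion)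
    have V: "V * inverse V = 1"
      using V0 by (simp add: less_top flip: divide_ennreal_def)
    have nn: "(\<integral>\<^sup>+x\<in>B. f x \<partial>lebesgue) = V * average B f" for f
    proof -
      have "V * average B f = (\<integral>\<^sup>+x\<in>B. f x \<partial>lebesgue) * (V * inverse V)"
        unfolding average_def V_def divide_ennreal_def by (simp only: mult_ac)
      then show ?thesis by (simp add: V)
    qed
    have "ennpowr (average B (\<lambda>x. ennpowr (ennreal (w x)) s)) (1 / s)
        = ennpowr (ennpowr (average B (\<lambda>x. ennpowr (ennreal (w x)) s)) (t / s)) (1 / t)"
      using s by (simp add: ennpowr_ennpowr)
    also have "\<dots> \<le> ennpowr (average B (\<lambda>x. ennpowr (ennpowr (ennreal (w x)) s) (t / s))) (1 / t)"
      using s V0 by (intro ennpowr_mono Jensen_average) (auto simp: V_def)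
    also have "\<dots> \<le> ennreal C * average B (\<lambda>x. ennreal (w x))"
      using s C[OF r, of 0] by (simp add: ennpowr_ennpowr B_def)
    also have "\<dots> \<le> ennreal (max C 1) * (W * inverse V)"
      by (auto simp: average_def divide_ennreal_def W_def emeasure_weight_measure[OF w] V_def
          simp del: emeasure_completion intro!: mult_right_mono ennreal_leI)
    finally have RH: "ennpowr (average B (\<lambda>x. ennpowr (ennreal (w x)) s)) (1 / s)
        \<le> ennreal (max C 1) * (W * inverse V)" .
    have "(\<integral>\<^sup>+x\<in>B. h x * ennreal (w x) \<partial>lebesgue)
        \<le> ennpowr (\<integral>\<^sup>+x\<in>B. ennpowr (h x) (s / (s - 1)) \<partial>lebesgue) (1 / (s / (s - 1)))
          * ennpowr (\<integral>\<^sup>+x\<in>B. ennpowr (ennreal (w x)) s \<partial>lebesgue) (1 / s)"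
      using s by (intro Hoelder_set_nn_integral) (auto simp: field_simps)
    also have "\<dots> = ennpowr V ((s - 1) / s) * ennpowr V (1 / s) * (ennpowr H ((s - 1) / s)
        * ennpowr (average B (\<lambda>x. ennpowr (ennreal (w x)) s)) (1 / s))"
      using s unfolding nn H_def by (simp add: ennpowr_mult mult_ac)
    also have "ennpowr V ((s - 1) / s) * ennpowr V (1 / s) = V"
      using ennpowr_add[of "(s - 1) / s" "1 / s" V] s by (simp add: diff_divide_distrib)
    also have "V * (ennpowr H ((s - 1) / s) * ennpowr (average B (\<lambda>x. ennpowr (ennreal (w x)) s)) (1 / s))
        \<le> V * (ennpowr H ((s - 1) / s) * (ennreal (max C 1) * (W * inverse V)))"
      by (intro mult_left_mono RH) auto
    also have "\<dots> = (V * inverse V) * (ennreal (max C 1) * ennpowr H ((s - 1) / s) * W)"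
      by (simp add: mult_ac)
    finally show "(\<integral>\<^sup>+x\<in>hball 0 r. h x * ennreal (w x) \<partial>lebesgue)
        \<le> ennreal (max C 1) * ennpowr (average (hball 0 r) (\<lambda>x. ennpowr (h x) (s / (s - 1)))) ((s - 1) / s)
          * emeasure (weight_measure w) (hball 0 r)"
      by (simp add: V B_def H_def W_def)
  qed simp
qed

section \<open>Positivity and growth of weights\<close>

lemma AE_by_hballs:
  fixes P :: "'n::finite heis \<Rightarrow> bool"
  assumes "\<And>n::nat. N \<le> n \<Longrightarrow> AE x in M. x \<in> hball 0 (real n) \<longrightarrow> P x"
  shows "AE x in M. P x"
proof -
  have "AE x in M. \<forall>n\<ge>N. x \<in> hball 0 (real n) \<longrightarrow> P x"
    using assms by (subst AE_all_countable) auto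
  then show ?thesis
  proof eventually_elim
    case (elim x)
    obtain k :: nat where "hnorm x < real k"
      using reals_Archimedean2 by blast
    then have "hnorm x < real (max k N)"
      by simp
    then show ?case
      using elim[rule_format, of "max k N"] by (simp add: hball_zero)
  qed
qed

text \<open>
  Apply the average inequality to the indicator \<open>g\<close> of the zero set of \<open>w\<close>: the right-hand
  side vanishes, so the zero set is null in every ball of positive weight.  If one ball has
  positive weight, then so have all larger ones.
\<close>
lemma Ap_weight_zero_or_pos:
  fixes w :: "'n::finite heis \<Rightarrow> real"
  assumes wA: "w \<in> Ap_weights q" and q: "1 \<le> q"
  shows "(AE x in lebesgue. w x = 0) \<or> (AE x in lebesgue. w x \<noteq> 0)"
proof (rule disjCI)
  assume not_pos: "\<not> (AE x in lebesgue. w x \<noteq> 0)"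
  have w: "weight w"
    using wA by (rule Ap_weights_imp_weight)
  note [measurable] = weight_measurable[OF w]
  define Z where "Z = {x. w x = 0}"
  have Z [measurable]: "Z \<in> sets lebesgue"
  proof -
    have "{x \<in> space lebesgue. w x = 0} \<in> sets lebesgue" by measurable
    then show ?thesis by (simp add: Z_def)
  qed
  obtain C where "0 < C" and C: "\<And>r g. 0 < r \<Longrightarrow> g \<in> borel_measurable lebesgue \<Longrightarrow>
      ennpowr (average (hball 0 r) g) q * emeasure (weight_measure w) (hball 0 r)
        \<le> ennreal C * (\<integral>\<^sup>+x\<in>hball 0 r. ennpowr (g x) q * ennreal (w x) \<partial>lebesgue)"
    by (rule Ap_average_le[OF wA q], rule that, assumption, blast)
  have zero: "average (hball 0 r) (indicator Z) = 0" if "0 < r" "emeasure (weight_measure w) (hball 0 r) \<noteq> 0" for r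
  proof -
    have "(\<integral>\<^sup>+x\<in>hball 0 r. ennpowr (indicator Z x) q * ennreal (w x) \<partial>lebesgue) = (\<integral>\<^sup>+x. 0 \<partial>(lebesgue :: 'n heis measure))"
      using q by (intro nn_integral_cong) (auto simp: indicator_def Z_def ennpowr_zero_left)
    with C[OF that(1), of "indicator Z"] that(2) q show ?thesis
      by (auto simp: ennpowr_eq_0_iff)
  qed
  show "AE x in lebesgue. w x = 0"
  proof (rule ccontr)
    assume "\<not> (AE x in lebesgue. w x = 0)"
    then obtain N :: nat where N: "\<not> (AE x in lebesgue. x \<in> hball 0 (real N) \<longrightarrow> w x = 0)"
      using AE_by_hballs[where N = 0 and M = lebesgue and P = "\<lambda>x. w x = 0"] by auto
    have "AE x in lebesgue. w x \<noteq> 0"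
    proof (rule AE_by_hballs[where N = "Suc N"])
      fix n assume n: "Suc N \<le> n"
      have "emeasure (weight_measure w) (hball 0 (real n)) \<noteq> 0"
      proof
        assume "emeasure (weight_measure w) (hball 0 (real n)) = 0"
        then have "AE x in lebesgue. ennreal (w x) * indicator (hball 0 (real n)) x = 0"
          by (simp add: emeasure_weight_measure[OF w] nn_integral_0_iff_AE)
        then have "AE x in lebesgue. x \<in> hball 0 (real N) \<longrightarrow> w x = 0"
        proof eventually_elim
          case (elim x)
          then show ?case
            using w n hball_zero_mono[of "real N" "real n", where 'a = 'n]
            by (auto simp: weight_def ennreal_eq_0_iff indicator_def split: if_splits intro: order_antisym)
        qed
        with N show False by simp
      qed
      with zero[of n] n have "(\<integral>\<^sup>+x. indicator Z x * indicator (hball 0 (real n)) x \<partial>lebesgue) = 0"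
        using emeasure_hball_zero_finite[of "real n", where 'a = 'n] by (simp add: average_def)
      then have "AE x in lebesgue. indicator Z x * indicator (hball 0 (real n)) x = (0 :: ennreal)"
        by (subst (asm) nn_integral_0_iff_AE) auto
      then show "AE x in lebesgue. x \<in> hball 0 (real n) \<longrightarrow> w x \<noteq> 0"
        by eventually_elim (auto simp: indicator_def Z_def split: if_splits)
    qed
    with not_pos show False by simp
  qed
qed

lemma emeasure_weight_measure_hball_pos:
  fixes w :: "'n::finite heis \<Rightarrow> real"
  assumes w: "weight w" and pos: "AE x in lebesgue. w x \<noteq> 0" and r: "0 < r"
  shows "emeasure (weight_measure w) (hball 0 r) \<noteq> 0"
proof
  note [measurable] = weight_measurable[OF w]
  assume "emeasure (weight_measure w) (hball 0 r) = 0"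
  then have "AE x in lebesgue. ennreal (w x) * indicator (hball 0 r) x = 0"
    by (simp add: emeasure_weight_measure[OF w] nn_integral_0_iff_AE)
  with pos have "AE x in lebesgue. x \<notin> (hball 0 r :: 'n heis set)"
    by eventually_elim
       (use w in \<open>auto simp: weight_def ennreal_eq_0_iff indicator_def split: if_splits intro: order_antisym\<close>)
  then have "hball 0 r \<in> null_sets (lebesgue :: 'n heis measure)"
    by (subst AE_iff_null_sets) auto
  with emeasure_hball_zero_pos[OF r, where 'n = 'n] show False
    by (simp add: null_sets_def)
qed

text \<open>
  The average inequality for the indicator of the smaller ball.
\<close>
lemma Ap_growth:
  fixes w :: "'n::finite heis \<Rightarrow> real"
  assumes wA: "w \<in> Ap_weights q" and q: "1 \<le> q"
  obtains C :: real where "0 < C"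
    and "\<And>r m. 0 < r \<Longrightarrow> 0 < m \<Longrightarrow> m \<le> 1 \<Longrightarrow>
      ennreal (m powr (real (hdim TYPE('n)) * q)) * emeasure (weight_measure w) (hball 0 r)
        \<le> ennreal C * emeasure (weight_measure w) (hball 0 (m * r))"
proof -
  have w: "weight w"
    using wA by (rule Ap_weights_imp_weight)
  obtain C where C0: "0 < C" and C: "\<And>r g. 0 < r \<Longrightarrow> g \<in> borel_measurable lebesgue \<Longrightarrow>
      ennpowr (average (hball 0 r) g) q * emeasure (weight_measure w) (hball 0 r)
        \<le> ennreal C * (\<integral>\<^sup>+x\<in>hball 0 r. ennpowr (g x) q * ennreal (w x) \<partial>lebesgue)"
    by (rule Ap_average_le[OF wA q], rule that, assumption, blast)
  show ?thesis
  proof (rule that[OF C0])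
    fix r m :: real assume rm: "0 < r" "0 < m" "m \<le> 1"
    then have le: "m * r \<le> r" by simp
    have "(\<integral>\<^sup>+x\<in>hball 0 r. ennpowr (indicator (hball 0 (m * r)) x) q * ennreal (w x) \<partial>lebesgue)
        = (\<integral>\<^sup>+x\<in>hball 0 (m * r). ennreal (w x) \<partial>lebesgue)"
      using q hball_zero_mono[OF le, where 'a = 'n]
      by (intro nn_integral_cong) (auto simp: indicator_def ennpowr_zero_left)
    moreover have "ennpowr (average (hball 0 r :: 'n heis set) (indicator (hball 0 (m * r)))) q
        = ennreal (m powr (real (hdim TYPE('n)) * q))"
      using rm by (simp add: average_indicator_hball[OF _ le] ennpowr_ennreal powr_powr flip: powr_realpow)
    ultimately show "ennreal (m powr (real (hdim TYPE('n)) * q)) * emeasure (weight_measure w) (hball 0 r)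
        \<le> ennreal C * emeasure (weight_measure w) (hball 0 (m * r))"
      using C[OF rm(1), of "indicator (hball 0 (m * r))"] by (simp add: emeasure_weight_measure[OF w])
  qed
qed

text \<open>
  Again the indicator of the smaller ball, now in the reverse Hoelder inequality over the
  larger one.
\<close>
lemma RH_growth:
  fixes w :: "'n::finite heis \<Rightarrow> real"
  assumes wR: "w \<in> RH_weights t" and s: "1 < s" "s \<le> t"
  obtains C :: real where "0 < C"
    and "\<And>r m. 0 < r \<Longrightarrow> 1 \<le> m \<Longrightarrow>
      ennreal (m powr (real (hdim TYPE('n)) * ((s - 1) / s))) * emeasure (weight_measure w) (hball 0 r)
        \<le> ennreal C * emeasure (weight_measure w) (hball 0 (m * r))"
proof -
  have w: "weight w"
    using wR by (rule RH_weights_imp_weight)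
  obtain C where C0: "0 < C" and C: "\<And>r h. 0 < r \<Longrightarrow> h \<in> borel_measurable lebesgue \<Longrightarrow>
      (\<integral>\<^sup>+x\<in>hball 0 r. h x * ennreal (w x) \<partial>lebesgue)
        \<le> ennreal C * ennpowr (average (hball 0 r) (\<lambda>x. ennpowr (h x) (s / (s - 1)))) ((s - 1) / s)
          * emeasure (weight_measure w) (hball 0 r)"
    by (rule RH_nn_integral_le[OF wR s], rule that, assumption, blast)
  show ?thesis
  proof (rule that[OF C0])
    fix r m :: real assume rm: "0 < r" "1 \<le> m"
    then have le: "r \<le> m * r" and mr: "0 < m * r" by simp_all
    let ?e = "real (hdim TYPE('n)) * ((s - 1) / s)"
    have "(\<integral>\<^sup>+x\<in>hball 0 (m * r). indicator (hball 0 r) x * ennreal (w x) \<partial>lebesgue)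
        = (\<integral>\<^sup>+x\<in>hball 0 r. ennreal (w x) \<partial>lebesgue)"
      using hball_zero_mono[OF le, where 'a = 'n] by (intro nn_integral_cong) (auto simp: indicator_def)
    moreover have "(\<lambda>x. ennpowr (indicator (hball 0 r) x) (s / (s - 1))) = (indicator (hball 0 r) :: 'n heis \<Rightarrow> ennreal)"
      using s by (auto simp: fun_eq_iff indicator_def ennpowr_zero_left)
    moreover have "ennpowr (average (hball 0 (m * r) :: 'n heis set) (indicator (hball 0 r))) ((s - 1) / s)
        = ennreal (m powr (- ?e))"
      using rm s by (simp add: average_indicator_hball[OF _ le] ennpowr_ennreal powr_powr powr_divide powr_minus_divide
        flip: powr_realpow)
    ultimately have "emeasure (weight_measure w) (hball 0 r)
        \<le> ennreal C * ennreal (m powr (- ?e)) * emeasure (weight_measure w) (hball 0 (m * r))"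
      using C[OF mr, of "indicator (hball 0 r)"] by (simp add: emeasure_weight_measure[OF w])
    then have "ennreal (m powr ?e) * emeasure (weight_measure w) (hball 0 r)
        \<le> ennreal (m powr ?e) * (ennreal C * ennreal (m powr (- ?e)) * emeasure (weight_measure w) (hball 0 (m * r)))"
      by (rule mult_left_mono) simp
    also have "\<dots> = ennreal (m powr ?e * m powr (- ?e)) * (ennreal C * emeasure (weight_measure w) (hball 0 (m * r)))"
      by (simp add: ennreal_mult mult_ac)
    also have "m powr ?e * m powr (- ?e) = 1"
      using rm by (simp flip: powr_add)
    finally show "ennreal (m powr ?e) * emeasure (weight_measure w) (hball 0 r)
        \<le> ennreal C * emeasure (weight_measure w) (hball 0 (m * r))"
      by simp
  qed
qed

lemma less_rh_indexE:
  assumes "ereal s < rh_index w"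
  obtains t where "s < t" "w \<in> RH_weights t"
proof -
  obtain e where "e \<in> ereal ` {r. r > 1 \<and> w \<in> RH_weights r}" "ereal s < e"
    using assms unfolding rh_index_def less_Sup_iff by blast
  then show ?thesis
    by (auto intro: that)
qed

text \<open>
  The norm of \<open>f \<circ> M\<close> is estimated with the power \<open>w(B(0, m r))\<^sup>l\<close>, where \<open>l < 0\<close>, so lower
  bounds for the weight of \<open>B(0, m r)\<close> are what is needed.  For \<open>m \<le> 1\<close> they come from the
  Muckenhoupt condition and for \<open>m > 1\<close> from the reverse Hoelder condition, which is the
  reason for the two parts of the constant in the theorem.
\<close>
lemma weight_growth_neg_power:
  fixes w :: "'n::finite heis \<Rightarrow> real"
  assumes wA: "w \<in> Ap_weights q" and q: "1 \<le> q" and pos: "AE x in lebesgue. w x \<noteq> 0"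
    and \<delta>: "1 < \<delta>" "ereal \<delta> < rh_index w" and l: "l < 0"
  obtains C :: real where "0 < C"
    and "\<And>r m. 0 < r \<Longrightarrow> 0 < m \<Longrightarrow>
      ennpowr (emeasure (weight_measure w) (hball 0 (m * r))) l
        \<le> ennreal (C * m powr (real (hdim TYPE('n)) * l * (if m > 1 then (\<delta> - 1) / \<delta> else q)))
          * ennpowr (emeasure (weight_measure w) (hball 0 r)) l"
proof -
  let ?Q = "real (hdim TYPE('n))" and ?e = "\<lambda>m. if m > 1 then (\<delta> - 1) / \<delta> else q"
  let ?W = "\<lambda>r. emeasure (weight_measure w) (hball 0 r)"
  have w: "weight w"
    using wA by (rule Ap_weights_imp_weight)
  obtain t where t: "\<delta> \<le> t" "w \<in> RH_weights t"
    using less_rh_indexE[OF \<delta>(2)] by (metis order_less_imp_le)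
  obtain C1 where C1: "0 < C1" "\<And>r m. 0 < r \<Longrightarrow> 0 < m \<Longrightarrow> m \<le> 1 \<Longrightarrow>
      ennreal (m powr (?Q * q)) * ?W r \<le> ennreal C1 * ?W (m * r)"
    by (rule Ap_growth[OF wA q], rule that, assumption, blast)
  obtain C2 where C2: "0 < C2" "\<And>r m. 0 < r \<Longrightarrow> 1 \<le> m \<Longrightarrow>
      ennreal (m powr (?Q * ((\<delta> - 1) / \<delta>))) * ?W r \<le> ennreal C2 * ?W (m * r)"
    by (rule RH_growth[OF t(2) \<delta>(1) t(1)], rule that, assumption, blast)
  define C where "C = max C1 C2"
  have C: "0 < C"
    using C1 by (simp add: C_def)
  have growth: "ennreal (m powr (?Q * ?e m)) * ?W r \<le> ennreal C * ?W (m * r)" if "0 < r" "0 < m" for r m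
  proof -
    have "ennreal C1 * ?W (m * r) \<le> ennreal C * ?W (m * r)" "ennreal C2 * ?W (m * r) \<le> ennreal C * ?W (m * r)"
      by (auto simp: C_def intro!: mult_right_mono ennreal_leI)
    then show ?thesis
      using C1(2)[OF that] C2(2)[OF that(1), of m] by (cases "m > 1") (auto intro: order_trans)
  qed
  show ?thesis
  proof (rule that[of "C powr (- l)"])
    fix r m :: real assume rm: "0 < r" "0 < m"
    obtain u where u: "0 < u" "?W r = ennreal u"
      using emeasure_weight_measure_hball_pos[OF w pos rm(1)] emeasure_weight_measure_hball_finite[OF w, of r]
      by (metis ennreal_cases_pos)
    obtain v where v: "0 < v" "?W (m * r) = ennreal v"
      using emeasure_weight_measure_hball_pos[OF w pos mult_pos_pos[OF rm(2,1)]]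
        emeasure_weight_measure_hball_finite[OF w, of "m * r"]
      by (metis ennreal_cases_pos)
    define K where "K = m powr (?Q * ?e m)"
    have K: "0 < K" "K powr l = m powr (?Q * l * ?e m)"
      using rm by (simp_all add: K_def powr_powr mult_ac)
    have "K * u \<le> C * v"
      using growth[OF rm] u v C K by (simp add: K_def[symmetric] flip: ennreal_mult)
    then have "(C * v) powr l \<le> (K * u) powr l"
      using l u C K by (intro powr_mono2') auto
    then have "C powr (- l) * (C * v) powr l \<le> C powr (- l) * (K * u) powr l"
      by (rule mult_left_mono) simp
    also have "C powr (- l) * (C * v) powr l = v powr l"
      using u v C by (simp add: powr_mult powr_minus)
    also have "C powr (- l) * (K * u) powr l = C powr (- l) * K powr l * u powr l"
      using K u by (simp add: powr_mult)
    also note K(2)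
    finally show "ennpowr (?W (m * r)) l
        \<le> ennreal (C powr (- l) * m powr (?Q * l * ?e m)) * ennpowr (?W r) l"
      using u v by (simp add: ennpowr_ennreal mult.assoc flip: ennreal_mult)
  qed (use C in simp)
qed

section \<open>Composition with a matrix\<close>

lemma measurable_matrix_vector:
  "(*v) (M :: real^'m^'k) \<in> borel_measurable borel"
  by (intro borel_measurable_continuous_onI linear_continuous_on) (simp add: matrix_vector_mul_bounded_linear)

text \<open>
  \<open>M\<close> maps \<open>B(0, r)\<close> into \<open>B(0, m r)\<close>, whose volume is \<open>m\<^sup>Q |B(0, r)|\<close>; the change of
  variables contributes \<open>|det M|\<^sup>-\<^sup>1\<close>.
\<close>
lemma average_matrix_le:
  fixes M :: "'n::finite heis_matrix"
  assumes det: "det M \<noteq> 0" and m: "hopnorm M = ennreal m" "0 < m" and r: "0 < r"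
    and g [measurable]: "g \<in> borel_measurable borel"
  shows "average (hball 0 r) (\<lambda>x. g (M *v x))
    \<le> ennreal (m ^ hdim TYPE('n) / \<bar>det M\<bar>) * average (hball 0 (m * r)) g"
proof -
  let ?Q = "hdim TYPE('n)" and ?V = "\<lambda>r. emeasure lebesgue (hball 0 r :: 'n heis set)"
  have mr: "0 < m * r" using m r by simp
  have V: "?V (m * r) = ennreal (m ^ ?Q) * ?V r"
    using emeasure_hball_zero[OF mr, where 'n = 'n] emeasure_hball_zero[OF r, where 'n = 'n] m r
    by (simp add: power_mult_distrib ennreal_mult mult_ac del: emeasure_completion)
  have "(\<integral>\<^sup>+x\<in>hball 0 r. g (M *v x) \<partial>lebesgue)
      \<le> (\<integral>\<^sup>+x. g (M *v x) * indicator (hball 0 (m * r)) (M *v x) \<partial>lborel)"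
    unfolding nn_integral_completion
  proof (intro nn_integral_mono mult_left_mono)
    fix x :: "'n heis"
    have "hnorm (M *v x) < m * r" if "hnorm x < r"
      using hnorm_matrix_le[OF m(1), of x] m that
      by (meson less_imp_le mult_strict_left_mono order_le_less_trans)
    then show "indicator (hball 0 r) x \<le> (indicator (hball 0 (m * r)) (M *v x) :: ennreal)"
      by (auto simp: indicator_def hball_zero)
  qed simp
  then have "ennreal \<bar>det M\<bar> * (\<integral>\<^sup>+x\<in>hball 0 r. g (M *v x) \<partial>lebesgue)
      \<le> ennreal \<bar>det M\<bar> * (\<integral>\<^sup>+x. g (M *v x) * indicator (hball 0 (m * r)) (M *v x) \<partial>lborel)"
    by (rule mult_left_mono) simp
  also have "\<dots> = (\<integral>\<^sup>+x\<in>hball 0 (m * r). g x \<partial>lebesgue)"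
    unfolding nn_integral_completion by (rule nn_integral_matrix_vector[OF det]) measurable
  finally have "ennreal (1 / \<bar>det M\<bar>) * (ennreal \<bar>det M\<bar> * (\<integral>\<^sup>+x\<in>hball 0 r. g (M *v x) \<partial>lebesgue))
      \<le> ennreal (1 / \<bar>det M\<bar>) * (\<integral>\<^sup>+x\<in>hball 0 (m * r). g x \<partial>lebesgue)"
    by (rule mult_left_mono) simp
  moreover have "ennreal (1 / \<bar>det M\<bar>) * ennreal \<bar>det M\<bar> = 1"
    using det by (simp flip: ennreal_mult)
  ultimately have *: "(\<integral>\<^sup>+x\<in>hball 0 r. g (M *v x) \<partial>lebesgue)
      \<le> ennreal (1 / \<bar>det M\<bar>) * (\<integral>\<^sup>+x\<in>hball 0 (m * r). g x \<partial>lebesgue)"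
    by (simp flip: mult.assoc)
  have "average (hball 0 r) (\<lambda>x. g (M *v x))
      \<le> ennreal (1 / \<bar>det M\<bar>) * (\<integral>\<^sup>+x\<in>hball 0 (m * r). g x \<partial>lebesgue) / ?V r"
    unfolding average_def by (rule divide_right_mono_ennreal[OF *])
  also have "inverse (?V r) = ennreal (m ^ ?Q) * inverse (?V (m * r))"
  proof -
    have "ennreal (m ^ ?Q) * inverse (?V (m * r)) = ennreal (m ^ ?Q) * inverse (ennreal (m ^ ?Q)) * inverse (?V r)"
      unfolding V using m emeasure_hball_zero_finite[of r, where 'a = 'n]
      by (subst ennreal_inverse_mult) (auto simp: less_top mult.assoc simp del: emeasure_completion)
    also have "ennreal (m ^ ?Q) * inverse (ennreal (m ^ ?Q)) = 1"
      using m by (simp add: inverse_ennreal flip: ennreal_mult)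
    finally show ?thesis by simp
  qed
  then have "ennreal (1 / \<bar>det M\<bar>) * (\<integral>\<^sup>+x\<in>hball 0 (m * r). g x \<partial>lebesgue) / ?V r
      = (ennreal (1 / \<bar>det M\<bar>) * ennreal (m ^ ?Q)) * average (hball 0 (m * r)) g"
    unfolding average_def divide_ennreal_def by (simp only: mult_ac)
  also have "ennreal (1 / \<bar>det M\<bar>) * ennreal (m ^ ?Q) = ennreal (m ^ ?Q / \<bar>det M\<bar>)"
    using m by (simp flip: ennreal_mult)
  finally show ?thesis .
qed

text \<open>
  The matrix factors of the two integrals in \<^const>\<open>hausdorff_const\<close> as one function, so
  that the constant becomes a single integral.
\<close>
definition hausdorff_factor :: "real \<Rightarrow> real \<Rightarrow> real \<Rightarrow> real \<Rightarrow> 'n::finite heis_matrix \<Rightarrow> ennreal" where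
  "hausdorff_factor p\<^sub>1 q l \<delta> M = matrix_factor (q / p\<^sub>1)
    (real (hdim TYPE('n)) * l * (if hopnorm M > 1 then (\<delta> - 1) / \<delta> else q)) M"

text \<open>
  The conjugate exponent is decreasing: \<open>a\<close> exceeds the conjugate of the critical index \<open>R\<close>
  exactly if the conjugate \<open>a / (a - 1)\<close> of \<open>a\<close> is below \<open>R\<close>.
\<close>
lemma critical_exponent:
  assumes "1 \<le> p\<^sub>2" "1 \<le> q" "p\<^sub>1 > p\<^sub>2 * q * conj_index R" "1 < \<delta>" "ereal \<delta> < R"
  defines "a \<equiv> p\<^sub>1 / (p\<^sub>2 * q)"
  shows "1 < a" "ereal (a / (a - 1)) < R"
proof -
  have pq: "0 < p\<^sub>2 * q"
    using assms by (intro mult_pos_pos) auto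
  have "1 < a \<and> ereal (a / (a - 1)) < R"
  proof (cases R)
    case PInf
    then have "1 < a"
      using assms pq by (simp add: conj_index_def field_simps)
    then show ?thesis using PInf by simp
  next
    case (real \<rho>)
    then have \<rho>: "1 < \<rho>" using assms by simp
    have "\<rho> / (\<rho> - 1) < a"
      using assms pq real by (simp add: conj_index_def field_simps)
    moreover have "1 < \<rho> / (\<rho> - 1)"
      using \<rho> by (simp add: field_simps)
    ultimately have a: "1 < a"
      by linarith
    with \<open>\<rho> / (\<rho> - 1) < a\<close> \<rho> show ?thesis
      using real by (simp add: field_simps)
  qed (use assms in simp)
  then show "1 < a" "ereal (a / (a - 1)) < R" by auto
qed

text \<open>
  The estimate for a single matrix.  With \<open>a = p\<^sub>1 / (p\<^sub>2 q)\<close> and its conjugate exponent \<open>s\<close>,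
  which is below the critical index, the reverse Hoelder condition for \<open>s\<close> replaces the
  weighted integral of \<open>(g \<circ> M)\<^sup>p\<^sup>2\<close> by the Lebesgue average of \<open>(g \<circ> M)\<^sup>p\<^sup>1\<^sup>/\<^sup>q\<close>; the
  change of variables removes \<open>M\<close>; the Muckenhoupt condition leads back to a weighted
  integral of \<open>g\<^sup>p\<^sup>1\<close>, now over \<open>B(0, m r)\<close>, which is controlled by the Morrey norm \<open>N\<close>; and
  the growth estimate compares the weights of the two balls.
\<close>
lemma matrix_composition_estimate:
  fixes w :: "'n::finite heis \<Rightarrow> real" and p\<^sub>1 p\<^sub>2 q l \<delta> :: real
  assumes p1: "1 \<le> p\<^sub>1" and p2: "1 \<le> p\<^sub>2" and q: "1 \<le> q" and l: "l < 0"
    and wA: "w \<in> Ap_weights q" and pos: "AE x in lebesgue. w x \<noteq> 0"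
    and p12: "p\<^sub>1 > p\<^sub>2 * q * conj_index (rh_index w)"
    and \<delta>: "1 < \<delta>" "ereal \<delta> < rh_index w"
  obtains C :: real where "0 < C"
    and "\<And>M g r N. det M \<noteq> 0 \<Longrightarrow> hopnorm M \<noteq> top \<Longrightarrow> g \<in> borel_measurable borel \<Longrightarrow> 0 < r \<Longrightarrow>
      (\<And>\<rho>. 0 < \<rho> \<Longrightarrow> (\<integral>\<^sup>+x\<in>hball 0 \<rho>. ennpowr (g x) p\<^sub>1 * ennreal (w x) \<partial>lebesgue)
        \<le> ennpowr N p\<^sub>1 * ennpowr (emeasure (weight_measure w) (hball 0 \<rho>)) (1 + p\<^sub>1 * l)) \<Longrightarrow>
      (\<integral>\<^sup>+x\<in>hball 0 r. ennpowr (g (M *v x)) p\<^sub>2 * ennreal (w x) \<partial>lebesgue)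
        \<le> ennreal C * ennpowr N p\<^sub>2 * ennpowr (emeasure (weight_measure w) (hball 0 r)) (1 + p\<^sub>2 * l)
          * ennpowr (hausdorff_factor p\<^sub>1 q l \<delta> M) p\<^sub>2"
proof -
  let ?Q = "hdim TYPE('n)" and ?W = "\<lambda>r. emeasure (weight_measure w) (hball 0 r)"
  have w: "weight w"
    using wA by (rule Ap_weights_imp_weight)
  define a where "a = p\<^sub>1 / (p\<^sub>2 * q)"
  define s where "s = a / (a - 1)"
  have a: "1 < a" "ereal s < rh_index w"
    using critical_exponent[OF p2 q p12 \<delta>] by (simp_all add: a_def s_def)
  have s: "1 < s" "s / (s - 1) = a" "(s - 1) / s = 1 / a"
    using a(1) by (simp_all add: s_def field_simps)
  obtain t where t: "s < t" "w \<in> RH_weights t"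
    using less_rh_indexE[OF a(2)] .
  obtain C1 where C1: "0 < C1" "\<And>r h. 0 < r \<Longrightarrow> h \<in> borel_measurable lebesgue \<Longrightarrow>
      (\<integral>\<^sup>+x\<in>hball 0 r. h x * ennreal (w x) \<partial>lebesgue)
        \<le> ennreal C1 * ennpowr (average (hball 0 r) (\<lambda>x. ennpowr (h x) (s / (s - 1)))) ((s - 1) / s) * ?W r"
    by (rule RH_nn_integral_le[OF t(2) s(1)], rule less_imp_le[OF t(1)], rule that, assumption, blast)
  obtain C2 where C2: "0 < C2" "\<And>r g. 0 < r \<Longrightarrow> g \<in> borel_measurable lebesgue \<Longrightarrow>
      ennpowr (average (hball 0 r) g) q * ?W r
        \<le> ennreal C2 * (\<integral>\<^sup>+x\<in>hball 0 r. ennpowr (g x) q * ennreal (w x) \<partial>lebesgue)"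
    by (rule Ap_average_le[OF wA q], rule that, assumption, blast)
  obtain C3 where C3: "0 < C3" "\<And>r m. 0 < r \<Longrightarrow> 0 < m \<Longrightarrow> ennpowr (?W (m * r)) l
      \<le> ennreal (C3 * m powr (real ?Q * l * (if m > 1 then (\<delta> - 1) / \<delta> else q))) * ennpowr (?W r) l"
    by (rule weight_growth_neg_power[OF wA q pos \<delta> l], rule that, assumption, blast)
  show ?thesis
  proof (rule that[of "C1 * C2 powr (p\<^sub>2 / p\<^sub>1) * C3 powr p\<^sub>2"])
    fix M :: "'n heis_matrix" and g :: "'n heis \<Rightarrow> ennreal" and r :: real and N :: ennreal
    assume det: "det M \<noteq> 0" and fin: "hopnorm M \<noteq> top" and g [measurable]: "g \<in> borel_measurable borel" and r: "0 < r"
      and N: "\<And>\<rho>. 0 < \<rho> \<Longrightarrow> (\<integral>\<^sup>+x\<in>hball 0 \<rho>. ennpowr (g x) p\<^sub>1 * ennreal (w x) \<partial>lebesgue)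
        \<le> ennpowr N p\<^sub>1 * ennpowr (?W \<rho>) (1 + p\<^sub>1 * l)"
    obtain m where m: "0 < m" "hopnorm M = ennreal m"
      using fin hopnorm_pos[OF det] by (metis ennreal_cases_pos)
    have mr: "0 < m * r" using m r by simp
    define t' \<kappa> where "t' = m ^ ?Q / \<bar>det M\<bar>"
      and "\<kappa> = m powr (real ?Q * l * (if m > 1 then (\<delta> - 1) / \<delta> else q))"
    have tk: "0 < t'" "0 < \<kappa>"
      using m det by (simp_all add: t'_def \<kappa>_def)
    have factor: "hausdorff_factor p\<^sub>1 q l \<delta> M = ennreal (t' powr (q / p\<^sub>1) * \<kappa>)"
      using m by (simp add: hausdorff_factor_def matrix_factor_def t'_def \<kappa>_def)
    define U where "U = ?W (m * r)"
    have U: "U \<noteq> 0" "U \<noteq> top"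
      using emeasure_weight_measure_hball_pos[OF w pos mr] emeasure_weight_measure_hball_finite[OF w]
      by (simp_all add: U_def)
    have W: "?W r \<noteq> 0" "?W r \<noteq> top"
      using emeasure_weight_measure_hball_pos[OF w pos r] emeasure_weight_measure_hball_finite[OF w]
      by simp_all
    define A1 where "A1 = average (hball 0 (m * r)) (\<lambda>x. ennpowr (g x) (p\<^sub>1 / q))"
    have leb: "h \<in> borel_measurable lebesgue" if "h \<in> borel_measurable borel" for h :: "'n heis \<Rightarrow> ennreal"
      using that by (intro measurable_completion) simp
    have gM [measurable]: "(\<lambda>x. g (M *v x)) \<in> borel_measurable borel"
      by (rule measurable_compose[OF measurable_matrix_vector g])
    \<comment> \<open>the average of \<open>g\<^sup>p\<^sup>1\<^sup>/\<^sup>q\<close> over the larger ball, by the Muckenhoupt condition\<close>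
    have "ennpowr A1 q * U \<le> ennreal C2 * (\<integral>\<^sup>+x\<in>hball 0 (m * r). ennpowr (ennpowr (g x) (p\<^sub>1 / q)) q * ennreal (w x) \<partial>lebesgue)"
      unfolding A1_def U_def by (intro C2(2) mr leb) measurable
    also have "\<dots> = ennreal C2 * (\<integral>\<^sup>+x\<in>hball 0 (m * r). ennpowr (g x) p\<^sub>1 * ennreal (w x) \<partial>lebesgue)"
      using q by (simp add: ennpowr_ennpowr)
    also have "\<dots> \<le> ennreal C2 * (ennpowr N p\<^sub>1 * ennpowr U (1 + p\<^sub>1 * l))"
      unfolding U_def by (intro mult_left_mono N mr) simp
    also have "\<dots> = ennreal C2 * ennpowr N p\<^sub>1 * ennpowr U (p\<^sub>1 * l) * U"
      using U by (simp add: ennpowr_add mult_ac)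
    finally have "ennpowr A1 q \<le> ennreal C2 * ennpowr N p\<^sub>1 * ennpowr U (p\<^sub>1 * l)"
      using U by (simp add: mult.commute[of _ U] ennreal_mult_le_mult_iff)
    then have "ennpowr (ennpowr A1 q) (p\<^sub>2 / p\<^sub>1)
        \<le> ennpowr (ennreal C2 * ennpowr N p\<^sub>1 * ennpowr U (p\<^sub>1 * l)) (p\<^sub>2 / p\<^sub>1)"
      using p1 p2 by (intro ennpowr_mono) auto
    also have "\<dots> = ennreal (C2 powr (p\<^sub>2 / p\<^sub>1)) * ennpowr N p\<^sub>2 * ennpowr (ennpowr U l) p\<^sub>2"
      using p1 p2 C2(1) by (simp add: ennpowr_mult ennpowr_ennpowr ennpowr_ennreal mult_ac)
    also have "\<dots> \<le> ennreal (C2 powr (p\<^sub>2 / p\<^sub>1)) * ennpowr N p\<^sub>2 * ennpowr (ennreal (C3 * \<kappa>) * ennpowr (?W r) l) p\<^sub>2"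
      using p2 C3(2)[OF r m(1)] by (intro mult_left_mono ennpowr_mono) (auto simp: U_def \<kappa>_def)
    finally have A1: "ennpowr A1 (q * (p\<^sub>2 / p\<^sub>1)) \<le> ennreal (C2 powr (p\<^sub>2 / p\<^sub>1)) * ennpowr N p\<^sub>2
        * ennpowr (ennreal (C3 * \<kappa>) * ennpowr (?W r) l) p\<^sub>2"
      by (simp only: ennpowr_ennpowr)
    \<comment> \<open>the passage to the larger ball, by the reverse Hoelder condition and the change of variables\<close>
    have exps: "p\<^sub>2 * a = p\<^sub>1 / q" "1 / a = q * (p\<^sub>2 / p\<^sub>1)"
      using p2 q by (simp_all add: a_def field_simps)
    have "(\<integral>\<^sup>+x\<in>hball 0 r. ennpowr (g (M *v x)) p\<^sub>2 * ennreal (w x) \<partial>lebesgue)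
        \<le> ennreal C1 * ennpowr (average (hball 0 r) (\<lambda>x. ennpowr (ennpowr (g (M *v x)) p\<^sub>2) (s / (s - 1)))) ((s - 1) / s) * ?W r"
      by (intro C1(2) r leb) measurable
    also have "\<dots> = ennreal C1 * ennpowr (average (hball 0 r) (\<lambda>x. ennpowr (g (M *v x)) (p\<^sub>1 / q))) (q * (p\<^sub>2 / p\<^sub>1)) * ?W r"
      unfolding s(2,3) ennpowr_ennpowr exps ..
    also have "\<dots> \<le> ennreal C1 * ennpowr (ennreal t' * A1) (q * (p\<^sub>2 / p\<^sub>1)) * ?W r"
      using average_matrix_le[OF det m(2,1) r, of "\<lambda>x. ennpowr (g x) (p\<^sub>1 / q)"] p1 p2 q
      by (intro mult_left_mono mult_right_mono ennpowr_mono) (auto simp: A1_def t'_def)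
    also have "\<dots> = ennreal C1 * (ennreal (t' powr (q * (p\<^sub>2 / p\<^sub>1))) * ennpowr A1 (q * (p\<^sub>2 / p\<^sub>1))) * ?W r"
      using p1 p2 q tk by (simp add: ennpowr_mult ennpowr_ennreal)
    also have "\<dots> \<le> ennreal C1 * (ennreal (t' powr (q * (p\<^sub>2 / p\<^sub>1))) * (ennreal (C2 powr (p\<^sub>2 / p\<^sub>1)) * ennpowr N p\<^sub>2
        * ennpowr (ennreal (C3 * \<kappa>) * ennpowr (?W r) l) p\<^sub>2)) * ?W r"
      by (intro mult_left_mono mult_right_mono A1) auto
    also have "ennpowr (ennreal (C3 * \<kappa>) * ennpowr (?W r) l) p\<^sub>2 = ennreal (C3 powr p\<^sub>2) * ennreal (\<kappa> powr p\<^sub>2) * ennpowr (?W r) (p\<^sub>2 * l)"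
      using p2 C3(1) tk by (simp add: ennpowr_mult ennpowr_ennpowr ennpowr_ennreal powr_mult ennreal_mult mult_ac)
    also have "ennreal C1 * (ennreal (t' powr (q * (p\<^sub>2 / p\<^sub>1))) * (ennreal (C2 powr (p\<^sub>2 / p\<^sub>1)) * ennpowr N p\<^sub>2
        * (ennreal (C3 powr p\<^sub>2) * ennreal (\<kappa> powr p\<^sub>2) * ennpowr (?W r) (p\<^sub>2 * l)))) * ?W r
      = (ennreal C1 * ennreal (C2 powr (p\<^sub>2 / p\<^sub>1)) * ennreal (C3 powr p\<^sub>2)) * ennpowr N p\<^sub>2 * (?W r * ennpowr (?W r) (p\<^sub>2 * l))
        * (ennreal (t' powr (q * (p\<^sub>2 / p\<^sub>1))) * ennreal (\<kappa> powr p\<^sub>2))"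
      by (simp only: mult_ac)
    also have "ennreal C1 * ennreal (C2 powr (p\<^sub>2 / p\<^sub>1)) * ennreal (C3 powr p\<^sub>2) = ennreal (C1 * C2 powr (p\<^sub>2 / p\<^sub>1) * C3 powr p\<^sub>2)"
      using C1(1) by (simp add: ennreal_mult)
    also have "?W r * ennpowr (?W r) (p\<^sub>2 * l) = ennpowr (?W r) (1 + p\<^sub>2 * l)"
      using W by (simp add: ennpowr_add)
    also have "ennreal (t' powr (q * (p\<^sub>2 / p\<^sub>1))) * ennreal (\<kappa> powr p\<^sub>2) = ennpowr (hausdorff_factor p\<^sub>1 q l \<delta> M) p\<^sub>2"
      using tk by (simp add: factor ennpowr_ennreal powr_mult powr_powr flip: ennreal_mult)
    finally show "(\<integral>\<^sup>+x\<in>hball 0 r. ennpowr (g (M *v x)) p\<^sub>2 * ennreal (w x) \<partial>lebesgue)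
        \<le> ennreal (C1 * C2 powr (p\<^sub>2 / p\<^sub>1) * C3 powr p\<^sub>2) * ennpowr N p\<^sub>2 * ennpowr (?W r) (1 + p\<^sub>2 * l)
          * ennpowr (hausdorff_factor p\<^sub>1 q l \<delta> M) p\<^sub>2" .
  qed (use C1 C2 C3 in simp)
qed

section \<open>Measurability of the Hausdorff operator\<close>

lemma measurable_det [measurable]: "(det :: real^'k^'k \<Rightarrow> real) \<in> borel_measurable borel"
  unfolding det_def by (intro borel_measurable_continuous_onI continuous_intros)

lemma measurable_hausdorff_factor [measurable]:
  "(hausdorff_factor p\<^sub>1 q l \<delta> :: 'n::finite heis_matrix \<Rightarrow> ennreal) \<in> borel_measurable borel"
  unfolding hausdorff_factor_def matrix_factor_def by measurable

lemma hausdorff_const_eq: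
  fixes \<Phi> :: "'n::finite heis \<Rightarrow> complex"
  assumes [measurable]: "\<Phi> \<in> borel_measurable lebesgue" "A \<in> borel_measurable lebesgue"
  shows "hausdorff_const p\<^sub>1 q l \<delta> \<Phi> A
    = (\<integral>\<^sup>+y. ennreal (norm (\<Phi> y) / hnorm y ^ hdim TYPE('n)) * hausdorff_factor p\<^sub>1 q l \<delta> (A y) \<partial>lebesgue)"
proof -
  have id [measurable]: "(\<lambda>y::'n heis. y) \<in> borel_measurable lebesgue"
    by (rule measurable_completion) simp
  have [measurable]: "(\<lambda>y::'n heis. hnorm y) \<in> borel_measurable lebesgue"
    by (rule measurable_completion) simp
  have [measurable]: "(\<lambda>M. matrix_factor a b M) \<in> borel_measurable (borel :: 'n heis_matrix measure)" for a b
    unfolding matrix_factor_def by measurable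
  have "{y \<in> space lebesgue. hopnorm (A y) > 1} \<in> sets lebesgue" "{y \<in> space lebesgue. hopnorm (A y) \<le> 1} \<in> sets lebesgue"
    by measurable
  then have [measurable]: "{y. hopnorm (A y) > 1} \<in> sets lebesgue" "{y. hopnorm (A y) \<le> 1} \<in> sets lebesgue"
    by simp_all
  show ?thesis
    unfolding hausdorff_const_def
    by (subst nn_integral_add[symmetric])
       (auto intro!: nn_integral_cong simp: hausdorff_factor_def indicator_def mult.assoc)
qed

lemma sigma_finite_lebesgue: "sigma_finite_measure lebesgue"
proof
  obtain F :: "'a set set" where F: "countable F" "F \<subseteq> sets lborel" "\<Union>F = space lborel" "\<forall>a\<in>F. emeasure lborel a \<noteq> \<infinity>"
    using lborel.sigma_finite_countable by blast
  then have "emeasure lebesgue a \<noteq> \<infinity>" if "a \<in> F" for a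
    using that by (subst emeasure_completion) auto
  with F show "\<exists>F::'a set set. countable F \<and> F \<subseteq> sets lebesgue \<and> \<Union>F = space lebesgue \<and> (\<forall>a\<in>F. emeasure lebesgue a \<noteq> \<infinity>)"
    by (intro exI[of _ F]) auto
qed

lemma measurable_matrix_action:
  fixes A :: "'n::finite heis \<Rightarrow> 'n heis_matrix"
  assumes [measurable]: "A \<in> borel_measurable lebesgue"
  shows "(\<lambda>(x, y). A y *v x) \<in> borel_measurable (lebesgue \<Otimes>\<^sub>M lebesgue)"
proof -
  have id [measurable]: "(\<lambda>x::'n heis. x) \<in> borel_measurable lebesgue"
    by (rule measurable_completion) simp
  have "continuous_on UNIV (\<lambda>p::'n heis_matrix \<times> 'n heis. fst p *v snd p)"
    unfolding matrix_vector_mult_def by (intro continuous_intros)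
  then have [measurable]: "(\<lambda>p::'n heis_matrix \<times> 'n heis. fst p *v snd p) \<in> borel_measurable (borel \<Otimes>\<^sub>M borel)"
    unfolding borel_prod by (rule borel_measurable_continuous_onI)
  have [measurable]: "(\<lambda>z. (A (snd z), fst z)) \<in> lebesgue \<Otimes>\<^sub>M lebesgue \<rightarrow>\<^sub>M borel \<Otimes>\<^sub>M (borel :: 'n heis measure)"
    by (intro measurable_Pair measurable_compose[OF measurable_snd assms] measurable_compose[OF measurable_fst id])
  show ?thesis
    using measurable_compose[OF \<open>(\<lambda>z. (A (snd z), fst z)) \<in> _\<close> \<open>(\<lambda>p. fst p *v snd p) \<in> _\<close>]
    by (simp add: split_beta')
qed

lemma AE_matrix_notin_null:
  fixes M :: "'n::finite heis_matrix"
  assumes det: "det M \<noteq> 0" and N: "N \<in> null_sets lborel"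
  shows "AE x in lebesgue. M *v x \<notin> N"
proof -
  have [measurable]: "N \<in> sets borel"
    using N by auto
  note [measurable] = measurable_matrix_vector[of M]
  have "ennreal \<bar>det M\<bar> * (\<integral>\<^sup>+x. indicator N (M *v x) \<partial>lborel) = 0"
    using N by (subst nn_integral_matrix_vector[OF det]) (auto simp: null_sets_def)
  then have "(\<integral>\<^sup>+x. indicator N (M *v x) \<partial>lborel) = (0 :: ennreal)"
    using det by simp
  then have "AE x in lborel. indicator N (M *v x) = (0 :: ennreal)"
    by (subst (asm) nn_integral_0_iff_AE) auto
  then have "AE x in lborel. M *v x \<notin> N"
    by eventually_elim (auto simp: indicator_def split: if_splits)
  then show ?thesis
    by (rule AE_completion)
qed

context
  fixes \<Phi> :: "'n::finite heis \<Rightarrow> complex" and A :: "'n heis \<Rightarrow> 'n heis_matrix"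
    and f f' :: "'n heis \<Rightarrow> complex"
  assumes \<Phi> [measurable]: "\<Phi> \<in> borel_measurable lebesgue"
    and A [measurable]: "A \<in> borel_measurable lebesgue"
    and det: "AE y in lebesgue. \<Phi> y \<noteq> 0 \<longrightarrow> det (A y) \<noteq> 0"
    and f' [measurable]: "f' \<in> borel_measurable borel"
    and eq: "AE x in lebesgue. f x = f' x"
begin

text \<open>
  A null set that contains \<open>{f \<noteq> f'}\<close> has null preimages under the invertible matrices
  \<open>A y\<close>, so by Fubini's theorem almost every \<open>x\<close> satisfies \<open>f (A y x) = f' (A y x)\<close> for
  almost every \<open>y\<close> with \<open>\<Phi> y \<noteq> 0\<close>.  For a Borel function \<open>f'\<close> the integrand is jointly measurable, whereas
  for a Lebesgue measurable \<open>f\<close> it need not be.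
\<close>
lemma hausdorff_integrand_AE_cong:
  "AE x in lebesgue. AE y in lebesgue. hausdorff_integrand \<Phi> A f x y = hausdorff_integrand \<Phi> A f' x y"
proof -
  interpret sigma_finite_measure "lebesgue :: 'n heis measure"
    by (rule sigma_finite_lebesgue)
  interpret pair_sigma_finite "lebesgue :: 'n heis measure" "lebesgue :: 'n heis measure" ..
  from eq have "AE x in lborel. f x = f' x"
    by (simp add: AE_completion_iff)
  then obtain N where N: "{x \<in> space lborel. f x \<noteq> f' x} \<subseteq> N" "N \<in> null_sets lborel"
    by (auto elim!: AE_E simp: null_sets_def)
  have [measurable]: "N \<in> sets borel"
    using N by auto
  note [measurable] = measurable_matrix_action[OF A, unfolded split_beta']
  have "AE y in lebesgue. AE x in lebesgue. \<Phi> y \<noteq> 0 \<longrightarrow> A y *v x \<notin> N"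
    using det
  proof eventually_elim
    case (elim y)
    show ?case
    proof (cases "\<Phi> y = 0")
      case False
      with AE_matrix_notin_null[OF _ N(2), of "A y"] elim show ?thesis by simp
    qed simp
  qed
  then have "AE x in lebesgue. AE y in lebesgue. \<Phi> y \<noteq> 0 \<longrightarrow> A y *v x \<notin> N"
    by (subst AE_commute) measurable
  then show ?thesis
  proof eventually_elim
    case (elim x)
    then show ?case
    proof eventually_elim
      case (elim y)
      then have "\<Phi> y = 0 \<or> f (A y *v x) = f' (A y *v x)"
        using N(1) by auto
      then show ?case
        by (auto simp: hausdorff_integrand_def)
    qed
  qed
qed

lemma hausdorff_integrand_measurable [measurable]:
  "case_prod (hausdorff_integrand \<Phi> A f') \<in> borel_measurable (lebesgue \<Otimes>\<^sub>M lebesgue)"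
proof -
  note [measurable] = measurable_matrix_action[OF A, unfolded split_beta']
  have [measurable]: "(\<lambda>y::'n heis. hnorm y) \<in> borel_measurable lebesgue"
    by (rule measurable_completion) simp
  show ?thesis
    unfolding hausdorff_integrand_def split_beta' by measurable
qed

lemma norm_hausdorff_integrand:
  "ennreal (norm (hausdorff_integrand \<Phi> A f' x y))
    = ennreal (norm (\<Phi> y) / hnorm y ^ hdim TYPE('n)) * ennreal (norm (f' (A y *v x)))"
  by (simp add: hausdorff_integrand_def norm_mult norm_divide norm_power flip: ennreal_mult)

lemma hausdorff_integrand_section_measurable:
  "AE x in lebesgue. hausdorff_integrand \<Phi> A f x \<in> borel_measurable lebesgue"
  using hausdorff_integrand_AE_cong
proof eventually_elim
  case (elim x)
  have "hausdorff_integrand \<Phi> A f' x \<in> borel_measurable lebesgue"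
    using measurable_compose[OF measurable_Pair1'[of x lebesgue lebesgue] hausdorff_integrand_measurable] by simp
  moreover from elim have "AE y in lebesgue. hausdorff_integrand \<Phi> A f' x y = hausdorff_integrand \<Phi> A f x y"
    by eventually_elim simp
  ultimately show ?case
    by (rule borel_measurable_AE)
qed

lemma borel_measurable_hausdorff: "hausdorff \<Phi> A f \<in> borel_measurable lebesgue"
proof (rule borel_measurable_AE)
  interpret sigma_finite_measure "lebesgue :: 'n heis measure"
    by (rule sigma_finite_lebesgue)
  show "(\<lambda>x. \<integral>y. hausdorff_integrand \<Phi> A f' x y \<partial>lebesgue) \<in> borel_measurable lebesgue"
    by (rule borel_measurable_lebesgue_integral) (rule hausdorff_integrand_measurable)
  have "AE x in lebesgue. hausdorff_integrand \<Phi> A f x \<in> borel_measurable lebesgue \<and>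
      hausdorff_integrand \<Phi> A f' x \<in> borel_measurable lebesgue"
    using hausdorff_integrand_section_measurable
  proof eventually_elim
    case (elim x)
    then show ?case
      using measurable_compose[OF measurable_Pair1'[of x lebesgue lebesgue] hausdorff_integrand_measurable] by simp
  qed
  with hausdorff_integrand_AE_cong
  show "AE x in lebesgue. (\<integral>y. hausdorff_integrand \<Phi> A f' x y \<partial>lebesgue) = hausdorff \<Phi> A f x"
  proof eventually_elim
    case (elim x)
    then show ?case
      unfolding hausdorff_def by (intro integral_cong_AE) (auto elim: eventually_mono)
  qed
qed

lemma hausdorff_integrand_nn_integral_cong:
  "AE x in lebesgue. (\<integral>\<^sup>+y. ennreal (norm (hausdorff_integrand \<Phi> A f x y)) \<partial>lebesgue)
    = (\<integral>\<^sup>+y. ennreal (norm (\<Phi> y) / hnorm y ^ hdim TYPE('n)) * ennreal (norm (f' (A y *v x))) \<partial>lebesgue)"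
  using hausdorff_integrand_AE_cong
proof eventually_elim
  case (elim x)
  then have "AE y in lebesgue. ennreal (norm (hausdorff_integrand \<Phi> A f x y))
      = ennreal (norm (\<Phi> y) / hnorm y ^ hdim TYPE('n)) * ennreal (norm (f' (A y *v x)))"
    by eventually_elim (simp add: norm_hausdorff_integrand)
  then show ?case
    by (rule nn_integral_cong_AE)
qed

lemma norm_hausdorff_le:
  "AE x in lebesgue. ennreal (norm (hausdorff \<Phi> A f x))
    \<le> (\<integral>\<^sup>+y. ennreal (norm (\<Phi> y) / hnorm y ^ hdim TYPE('n)) * ennreal (norm (f' (A y *v x))) \<partial>lebesgue)"
  using hausdorff_integrand_nn_integral_cong
proof eventually_elim
  case (elim x)
  show ?case
  proof (cases "integrable lebesgue (hausdorff_integrand \<Phi> A f x)")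
    case True
    from integral_norm_bound_ennreal[OF this] show ?thesis
      by (simp add: hausdorff_def elim)
  qed (simp add: hausdorff_def not_integrable_integral_eq)
qed

lemma integrable_hausdorff_integrand:
  assumes "AE x in lebesgue. (\<integral>\<^sup>+y. ennreal (norm (\<Phi> y) / hnorm y ^ hdim TYPE('n))
      * ennreal (norm (f' (A y *v x))) \<partial>lebesgue) \<noteq> top"
  shows "AE x in lebesgue. integrable lebesgue (hausdorff_integrand \<Phi> A f x)"
  using assms hausdorff_integrand_nn_integral_cong hausdorff_integrand_section_measurable
  by eventually_elim (simp add: integrable_iff_bounded less_top)

end

section \<open>Morrey norms\<close>

lemma Lp_integrand_eq:
  assumes "weight w" "0 < p"
  shows "ennreal (norm z powr p * w x) = ennpowr (ennreal (norm z)) p * ennreal (w x)"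
  using assms by (simp add: weight_def ennpowr_ennreal_nonneg ennreal_mult)

lemma morrey_norm_bound:
  fixes w :: "'n::finite heis \<Rightarrow> real"
  assumes w: "weight w" and pos: "AE x in lebesgue. w x \<noteq> 0" and p: "1 \<le> p" and r: "0 < r"
  shows "(\<integral>\<^sup>+x\<in>hball 0 r. ennpowr (ennreal (norm (f x))) p * ennreal (w x) \<partial>lebesgue)
    \<le> ennpowr (morrey_norm p l w f) p * ennpowr (emeasure (weight_measure w) (hball 0 r)) (1 + p * l)"
proof -
  define X where "X = ennpowr (emeasure (weight_measure w) (hball 0 r)) (1 + p * l)"
  define I where "I = (\<integral>\<^sup>+x\<in>hball 0 r. ennpowr (ennreal (norm (f x))) p * ennreal (w x) \<partial>lebesgue)"
  have X: "X \<noteq> 0" "X \<noteq> top"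
    using ennpowr_finite[OF emeasure_weight_measure_hball_pos[OF w pos r] emeasure_weight_measure_hball_finite[OF w]]
    by (simp_all add: X_def)
  have I: "I = (\<integral>\<^sup>+x\<in>hball 0 r. ennreal (norm (f x) powr p * w x) \<partial>lebesgue)"
    using p by (simp add: I_def Lp_integrand_eq[OF w])
  have "ennpowr (1 / X * I) (1 / p) \<le> morrey_norm p l w f"
    unfolding morrey_norm_def I X_def using r by (intro SUP_upper2[of r]) auto
  then have "ennpowr (ennpowr (1 / X * I) (1 / p)) p \<le> ennpowr (morrey_norm p l w f) p"
    using p by (intro ennpowr_mono) auto
  then have "X * (1 / X * I) \<le> X * ennpowr (morrey_norm p l w f) p"
    using p by (intro mult_left_mono) (auto simp: ennpowr_ennpowr)
  moreover have "X * (1 / X * I) = I"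
    using X by (simp add: less_top ennreal_times_divide flip: mult.assoc)
  ultimately show ?thesis
    by (simp add: I_def X_def mult.commute)
qed

lemma morrey_norm_leI:
  fixes w :: "'n::finite heis \<Rightarrow> real"
  assumes w: "weight w" and pos: "AE x in lebesgue. w x \<noteq> 0" and p: "1 \<le> p"
    and bound: "\<And>r. 0 < r \<Longrightarrow> (\<integral>\<^sup>+x\<in>hball 0 r. ennpowr (ennreal (norm (f x))) p * ennreal (w x) \<partial>lebesgue)
      \<le> ennpowr B p * ennpowr (emeasure (weight_measure w) (hball 0 r)) (1 + p * l)"
  shows "morrey_norm p l w f \<le> B"
  unfolding morrey_norm_def
proof (rule SUP_least)
  fix r :: real assume "r \<in> {0<..}"
  then have r: "0 < r" by simp
  define X where "X = ennpowr (emeasure (weight_measure w) (hball 0 r)) (1 + p * l)"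
  have X: "X \<noteq> 0" "X \<noteq> top"
    using ennpowr_finite[OF emeasure_weight_measure_hball_pos[OF w pos r] emeasure_weight_measure_hball_finite[OF w]]
    by (simp_all add: X_def)
  have "1 / X * (\<integral>\<^sup>+x\<in>hball 0 r. ennreal (norm (f x) powr p * w x) \<partial>lebesgue) \<le> 1 / X * (ennpowr B p * X)"
    using bound[OF r] p by (intro mult_left_mono) (auto simp: X_def Lp_integrand_eq[OF w])
  also have "\<dots> = ennpowr B p * (X * (1 / X))"
    by (simp only: mult_ac)
  also have "X * (1 / X) = 1"
    using X by (simp add: less_top ennreal_times_divide)
  finally have "ennpowr (1 / X * (\<integral>\<^sup>+x\<in>hball 0 r. ennreal (norm (f x) powr p * w x) \<partial>lebesgue)) (1 / p)
      \<le> ennpowr (ennpowr B p) (1 / p)"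
    using p by (intro ennpowr_mono) auto
  then show "ennpowr (1 / ennpowr (emeasure (weight_measure w) (hball 0 r)) (1 + p * l) *
        (\<integral>\<^sup>+x\<in>hball 0 r. ennreal (norm (f x) powr p * w x) \<partial>lebesgue)) (1 / p) \<le> B"
    using p by (simp add: X_def ennpowr_ennpowr)
qed

lemma Lp_locI:
  assumes w: "weight w" and p: "1 \<le> p" and "f \<in> borel_measurable lebesgue"
    and "\<And>r. 0 < r \<Longrightarrow> (\<integral>\<^sup>+x\<in>hball 0 r. ennpowr (ennreal (norm (f x))) p * ennreal (w x) \<partial>lebesgue) \<noteq> top"
  shows "f \<in> Lp_loc p w"
proof -
  have "(\<integral>\<^sup>+x\<in>K. ennreal (norm (f x) powr p * w x) \<partial>lebesgue) < \<infinity>" if K: "compact K" for K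
  proof -
    obtain r where r: "0 < r" "K \<subseteq> hball 0 r"
      using compact_subset_hball_zero[OF K] .
    have "(\<integral>\<^sup>+x\<in>K. ennreal (norm (f x) powr p * w x) \<partial>lebesgue)
        \<le> (\<integral>\<^sup>+x\<in>hball 0 r. ennpowr (ennreal (norm (f x))) p * ennreal (w x) \<partial>lebesgue)"
      using r p by (intro nn_integral_mono) (auto simp: indicator_def Lp_integrand_eq[OF w])
    also have "\<dots> < top"
      using assms(4)[OF r(1)] by (simp add: less_top)
    finally show ?thesis by simp
  qed
  with assms(3) show ?thesis
    by (simp add: Lp_loc_def)
qed

lemma matrix_factor_nonzero:
  assumes "det M \<noteq> 0"
  shows "matrix_factor a b M \<noteq> 0"
proof (cases "hopnorm M = top")
  case False
  then obtain m where m: "0 < m" "hopnorm M = ennreal m"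
    using hopnorm_pos[OF assms] by (metis ennreal_cases_pos)
  with assms show ?thesis
    by (simp add: matrix_factor_def ennreal_eq_0_iff not_le)
qed (simp add: matrix_factor_def)

section \<open>Boundedness of the Hausdorff operator\<close>

text \<open>
  Minkowski's inequality in \<open>L\<^sup>p\<close> of the ball with the measure \<open>w(x) dx\<close>; the bound for the
  \<open>p\<close>-th power of the norm of \<open>x \<mapsto> f' (A y x)\<close> is \<open>D\<close> times the \<open>p\<close>-th power of the matrix
  factor of \<open>A y\<close>.
\<close>
lemma hausdorff_nn_integral_le:
  fixes w :: "'n::finite heis \<Rightarrow> real" and f' :: "'n heis \<Rightarrow> complex"
  assumes w: "weight w" and p: "1 \<le> p" and r: "0 < r"
    and \<Phi> [measurable]: "\<Phi> \<in> borel_measurable lebesgue"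
    and A [measurable]: "A \<in> borel_measurable lebesgue"
    and det: "AE y in lebesgue. \<Phi> y \<noteq> 0 \<longrightarrow> det (A y) \<noteq> 0"
    and f' [measurable]: "f' \<in> borel_measurable borel"
    and bound: "\<And>M. det M \<noteq> 0 \<Longrightarrow> hopnorm M \<noteq> top \<Longrightarrow>
      (\<integral>\<^sup>+x\<in>hball 0 r. ennpowr (ennreal (norm (f' (M *v x)))) p * ennreal (w x) \<partial>lebesgue)
        \<le> D * ennpowr (hausdorff_factor p\<^sub>1 q l \<delta> M) p"
    and fin: "hausdorff_const p\<^sub>1 q l \<delta> \<Phi> A \<noteq> top"
  shows "(\<integral>\<^sup>+x\<in>hball 0 r. ennpowr (\<integral>\<^sup>+y. ennreal (norm (\<Phi> y) / hnorm y ^ hdim TYPE('n))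
      * ennreal (norm (f' (A y *v x))) \<partial>lebesgue) p * ennreal (w x) \<partial>lebesgue)
    \<le> D * ennpowr (hausdorff_const p\<^sub>1 q l \<delta> \<Phi> A) p"
proof -
  note [measurable] = weight_measurable[OF w]
  note act [measurable] = measurable_matrix_action[OF A, unfolded split_beta']
  have hn [measurable]: "(\<lambda>y::'n heis. hnorm y) \<in> borel_measurable lebesgue"
    by (rule measurable_completion) simp
  define \<mu> where "\<mu> = density lebesgue (\<lambda>x. ennreal (w x) * indicator (hball 0 r) x)"
  have sets: "sets \<mu> = sets lebesgue"
    by (simp add: \<mu>_def)
  have nn: "(\<integral>\<^sup>+x. g x \<partial>\<mu>) = (\<integral>\<^sup>+x\<in>hball 0 r. g x * ennreal (w x) \<partial>lebesgue)"
    if [measurable]: "g \<in> borel_measurable lebesgue" for g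
    unfolding \<mu>_def by (subst nn_integral_density) (auto intro!: nn_integral_cong simp: mult_ac)
  have "emeasure \<mu> (space \<mu>) = emeasure (weight_measure w) (hball 0 r)"
    by (simp add: \<mu>_def emeasure_density emeasure_weight_measure[OF w])
  then have "finite_measure \<mu>"
    using emeasure_weight_measure_hball_finite[OF w, of r] by (intro finite_measureI) simp
  then have "sigma_finite_measure \<mu>"
    by (rule finite_measure.axioms(1))
  define k where "k y = ennreal (norm (\<Phi> y) / hnorm y ^ hdim TYPE('n))" for y
  define G where "G x y = ennreal (norm (f' (A y *v x)))" for x y
  define m where "m y = hausdorff_factor p\<^sub>1 q l \<delta> (A y)" for y
  have k [measurable]: "k \<in> borel_measurable lebesgue"
    unfolding k_def by measurable
  have m [measurable]: "m \<in> borel_measurable lebesgue"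
    unfolding m_def by measurable
  have G [measurable]: "case_prod G \<in> borel_measurable (lebesgue \<Otimes>\<^sub>M lebesgue)"
    unfolding G_def split_beta' by measurable
  have G\<mu>: "case_prod G \<in> borel_measurable (\<mu> \<Otimes>\<^sub>M lebesgue)"
    using G by (simp add: measurable_cong_sets[OF sets_pair_measure_cong[OF sets refl] refl])
  have Gy: "(\<lambda>x. G x y) \<in> borel_measurable lebesgue" for y
    using measurable_compose[OF measurable_Pair2'[of y lebesgue lebesgue] G] by simp
  have "AE y in lebesgue. k y \<noteq> 0 \<longrightarrow> m y \<noteq> 0 \<and>
      (m y \<noteq> top \<longrightarrow> (\<integral>\<^sup>+x. ennpowr (G x y) p \<partial>\<mu>) \<le> D * ennpowr (m y) p)"
    using det
  proof eventually_elim
    case (elim y)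
    show ?case
    proof (intro impI conjI)
      assume "k y \<noteq> 0"
      then have d: "det (A y) \<noteq> 0"
        using elim by (auto simp: k_def)
      then show "m y \<noteq> 0"
        by (simp add: m_def hausdorff_factor_def matrix_factor_nonzero)
      assume "m y \<noteq> top"
      then have "hopnorm (A y) \<noteq> top"
        by (auto simp: m_def hausdorff_factor_def matrix_factor_def)
      with bound[OF d] show "(\<integral>\<^sup>+x. ennpowr (G x y) p \<partial>\<mu>) \<le> D * ennpowr (m y) p"
        using Gy[of y] by (subst nn) (auto simp: G_def m_def)
    qed
  qed
  moreover have K: "hausdorff_const p\<^sub>1 q l \<delta> \<Phi> A = (\<integral>\<^sup>+y. k y * m y \<partial>lebesgue)"
    by (simp add: hausdorff_const_eq[OF \<Phi> A] k_def m_def)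
  ultimately have "(\<integral>\<^sup>+x. ennpowr (\<integral>\<^sup>+y. k y * G x y \<partial>lebesgue) p \<partial>\<mu>)
      \<le> D * ennpowr (\<integral>\<^sup>+y. k y * m y \<partial>lebesgue) p"
    using fin \<open>sigma_finite_measure \<mu>\<close> sigma_finite_lebesgue p G\<mu> k m
    by (intro Minkowski_nn_integral) auto
  moreover have "(\<lambda>x. ennpowr (\<integral>\<^sup>+y. k y * G x y \<partial>lebesgue) p) \<in> borel_measurable lebesgue"
  proof -
    interpret sigma_finite_measure "lebesgue :: 'n heis measure"
      by (rule sigma_finite_lebesgue)
    show ?thesis
      by measurable
  qed
  ultimately show ?thesis
    by (subst (asm) nn) (auto simp: K k_def G_def)
qed

lemma nn_integral_hball_mono_AE:
  assumes "AE x in lebesgue. g x \<le> h x" "0 \<le> p"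
  shows "(\<integral>\<^sup>+x\<in>hball 0 r. ennpowr (g x) p * ennreal (w x) \<partial>lebesgue)
    \<le> (\<integral>\<^sup>+x\<in>hball 0 r. ennpowr (h x) p * ennreal (w x) \<partial>lebesgue)"
proof (rule nn_integral_mono_AE, use assms(1) in eventually_elim)
  case (elim x)
  then show ?case
    using assms(2) by (intro mult_right_mono ennpowr_mono) auto
qed

lemma morrey_norm_zero_imp_AE_zero:
  fixes w :: "'n::finite heis \<Rightarrow> real"
  assumes w: "weight w" and pos: "AE x in lebesgue. w x \<noteq> 0" and p: "1 \<le> p"
    and f [measurable]: "f \<in> borel_measurable lebesgue" and 0: "morrey_norm p l w f = 0"
  shows "AE x in lebesgue. f x = 0"
proof (rule AE_by_hballs[where N = 1])
  note [measurable] = weight_measurable[OF w]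
  fix n :: nat assume "1 \<le> n"
  then have "(\<integral>\<^sup>+x\<in>hball 0 (real n). ennpowr (ennreal (norm (f x))) p * ennreal (w x) \<partial>lebesgue) \<le> 0"
    using morrey_norm_bound[OF w pos p, of "real n" f l] p by (simp add: 0 ennpowr_zero_left)
  then have "AE x in lebesgue. ennpowr (ennreal (norm (f x))) p * ennreal (w x) * indicator (hball 0 (real n)) x = 0"
    by (simp add: nn_integral_0_iff_AE)
  with pos show "AE x in lebesgue. x \<in> hball 0 (real n) \<longrightarrow> f x = 0"
  proof eventually_elim
    case (elim x)
    moreover have "ennreal (w x) \<noteq> 0"
      using elim(1) w by (auto simp: weight_def ennreal_eq_0_iff intro: order_antisym)
    ultimately show ?case
      using p by (auto simp: ennpowr_eq_0_iff indicator_def)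
  qed
qed

lemma complex_borel_representative:
  fixes f :: "'a::euclidean_space \<Rightarrow> complex"
  assumes "f \<in> borel_measurable lebesgue"
  obtains f' where "f' \<in> borel_measurable borel" "AE x in lebesgue. f x = f' x"
proof -
  have "(\<lambda>x. Re (f x)) \<in> borel_measurable lebesgue" "(\<lambda>x. Im (f x)) \<in> borel_measurable lebesgue"
    using assms by measurable
  from this[THEN completion_ex_borel_measurable_real]
  obtain u v where uv: "u \<in> borel_measurable lborel" "v \<in> borel_measurable lborel"
    "AE x in lborel. Re (f x) = u x" "AE x in lborel. Im (f x) = v x"
    by blast
  show ?thesis
  proof (rule that)
    have [measurable]: "u \<in> borel_measurable borel" "v \<in> borel_measurable borel"
      using uv by simp_all
    show "(\<lambda>x. Complex (u x) (v x)) \<in> borel_measurable borel"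
      unfolding Complex_eq by measurable
    from uv(3,4) have "AE x in lborel. f x = Complex (u x) (v x)"
      by eventually_elim (simp add: complex_eq_iff)
    then show "AE x in lebesgue. f x = Complex (u x) (v x)"
      by (rule AE_completion)
  qed
qed

text \<open>
  All Morrey norms vanish: the integral is \<open>0\<close>, and so is its product with
  \<open>1 / w(B)\<^sup>1\<^sup>+\<^sup>p\<^sup>l\<close>, even where that factor is \<open>\<infinity>\<close>.
\<close>
lemma vanishing_weight:
  fixes w :: "'n::finite heis \<Rightarrow> real"
  assumes w: "weight w" and zero: "AE x in lebesgue. w x = 0" and p: "1 \<le> p"
  shows "AE x in weight_measure w. P x"
    and "g \<in> borel_measurable lebesgue \<Longrightarrow> g \<in> morrey_space p l w"
    and "morrey_norm p l w g = 0"
proof -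
  note [measurable] = weight_measurable[OF w]
  show "AE x in weight_measure w. P x"
    unfolding weight_measure_def
    by (subst AE_density) (use zero in \<open>auto elim: eventually_mono\<close>)
  have 0: "(\<integral>\<^sup>+x\<in>E. ennreal (norm (g x) powr p * w x) \<partial>lebesgue) = 0" for E
  proof -
    have "(\<integral>\<^sup>+x\<in>E. ennreal (norm (g x) powr p * w x) \<partial>lebesgue) = (\<integral>\<^sup>+x. 0 \<partial>(lebesgue :: 'n heis measure))"
      by (rule nn_integral_cong_AE) (use zero in \<open>auto elim: eventually_mono\<close>)
    then show ?thesis by simp
  qed
  show *: "morrey_norm p l w g = 0"
    using p by (simp add: morrey_norm_def 0 ennpowr_zero_left)
  show "g \<in> morrey_space p l w" if "g \<in> borel_measurable lebesgue"
    using that by (simp add: morrey_space_def Lp_loc_def * 0)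
qed

theorem theorem1p1:
  fixes w :: "'n::finite heis \<Rightarrow> real" and p\<^sub>1 p\<^sub>2 q l \<delta> :: real
  assumes "1 \<le> p\<^sub>1" and "1 \<le> p\<^sub>2" and "1 \<le> q"
    and "- 1 / p\<^sub>1 \<le> l" and "l < 0"
    and "w \<in> Ap_weights q"
    and "p\<^sub>1 > p\<^sub>2 * q * conj_index (rh_index w)"
    and "1 < \<delta>" and "ereal \<delta> < rh_index w"
  shows "\<exists>C::real. C > 0 \<and>
    (\<forall>\<Phi> A f. locally_integrable \<Phi> \<longrightarrow>
      A \<in> borel_measurable lebesgue \<longrightarrow>
      (AE y in lebesgue. \<Phi> y \<noteq> 0 \<longrightarrow> det (A y) \<noteq> 0) \<longrightarrow>
      f \<in> morrey_space p\<^sub>1 l w \<longrightarrow>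
        (hausdorff_const p\<^sub>1 q l \<delta> \<Phi> A < \<infinity> \<longrightarrow>
          (AE x in weight_measure w. integrable lebesgue (hausdorff_integrand \<Phi> A f x)) \<and>
          hausdorff \<Phi> A f \<in> morrey_space p\<^sub>2 l w) \<and>
        morrey_norm p\<^sub>2 l w (hausdorff \<Phi> A f)
          \<le> ennreal C * hausdorff_const p\<^sub>1 q l \<delta> \<Phi> A * morrey_norm p\<^sub>1 l w f)"
proof -
  have w: "weight w"
    using assms(6) by (rule Ap_weights_imp_weight)
  note [measurable] = weight_measurable[OF w]
  show ?thesis
  proof (cases "AE x in lebesgue. w x = 0")
    case True
    show ?thesis
    proof (intro exI[of _ 1] conjI allI impI)
      fix \<Phi> :: "'n heis \<Rightarrow> complex" and A :: "'n heis \<Rightarrow> 'n heis_matrix" and f :: "'n heis \<Rightarrow> complex"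
      assume \<Phi>: "locally_integrable \<Phi>" and A: "A \<in> borel_measurable lebesgue"
        and det: "AE y in lebesgue. \<Phi> y \<noteq> 0 \<longrightarrow> det (A y) \<noteq> 0"
        and f: "f \<in> morrey_space p\<^sub>1 l w"
      have "f \<in> borel_measurable lebesgue"
        using f by (simp add: morrey_space_def Lp_loc_def)
      then obtain f' where f': "f' \<in> borel_measurable borel" "AE x in lebesgue. f x = f' x"
        by (rule complex_borel_representative)
      note null = vanishing_weight[OF w True assms(2)]
      show "AE x in weight_measure w. integrable lebesgue (hausdorff_integrand \<Phi> A f x)"
        by (rule null)
      show "hausdorff \<Phi> A f \<in> morrey_space p\<^sub>2 l w"
        by (intro null(2) borel_measurable_hausdorff[OF _ A det f'] locally_integrable_measurable \<Phi>)
      show "morrey_norm p\<^sub>2 l w (hausdorff \<Phi> A f)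
          \<le> ennreal 1 * hausdorff_const p\<^sub>1 q l \<delta> \<Phi> A * morrey_norm p\<^sub>1 l w f"
        by (simp add: null(3))
    qed simp
  next
    case False
    then have pos: "AE x in lebesgue. w x \<noteq> 0"
      using Ap_weight_zero_or_pos[OF assms(6,3)] by simp
    let ?W = "\<lambda>r. emeasure (weight_measure w) (hball 0 r)"
    obtain C where C: "0 < C" "\<And>M g r N. det M \<noteq> 0 \<Longrightarrow> hopnorm M \<noteq> top \<Longrightarrow> g \<in> borel_measurable borel \<Longrightarrow> 0 < r \<Longrightarrow>
      (\<And>\<rho>. 0 < \<rho> \<Longrightarrow> (\<integral>\<^sup>+x\<in>hball 0 \<rho>. ennpowr (g x) p\<^sub>1 * ennreal (w x) \<partial>lebesgue)
        \<le> ennpowr N p\<^sub>1 * ennpowr (?W \<rho>) (1 + p\<^sub>1 * l)) \<Longrightarrow>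
      (\<integral>\<^sup>+x\<in>hball 0 r. ennpowr (g (M *v x)) p\<^sub>2 * ennreal (w x) \<partial>lebesgue)
        \<le> ennreal C * ennpowr N p\<^sub>2 * ennpowr (?W r) (1 + p\<^sub>2 * l) * ennpowr (hausdorff_factor p\<^sub>1 q l \<delta> M) p\<^sub>2"
      by (rule matrix_composition_estimate[OF assms(1-3,5,6) pos assms(7-9)], rule that, assumption, blast)
    show ?thesis
    proof (intro exI[of _ "C powr (1 / p\<^sub>2)"] allI impI conjI[OF _ allI[OF allI[OF allI[OF impI[OF impI[OF impI[OF impI]]]]]]])
      show "0 < C powr (1 / p\<^sub>2)"
        using C(1) by simp
      fix \<Phi> :: "'n heis \<Rightarrow> complex" and A :: "'n heis \<Rightarrow> 'n heis_matrix" and f :: "'n heis \<Rightarrow> complex"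
      assume \<Phi>: "locally_integrable \<Phi>" and A: "A \<in> borel_measurable lebesgue"
        and det: "AE y in lebesgue. \<Phi> y \<noteq> 0 \<longrightarrow> det (A y) \<noteq> 0"
        and f: "f \<in> morrey_space p\<^sub>1 l w"
      define N K where "N = morrey_norm p\<^sub>1 l w f" and "K = hausdorff_const p\<^sub>1 q l \<delta> \<Phi> A"
      have \<Phi>m: "\<Phi> \<in> borel_measurable lebesgue"
        using \<Phi> by (rule locally_integrable_measurable)
      have fm: "f \<in> borel_measurable lebesgue" and N: "N \<noteq> top"
        using f by (auto simp: morrey_space_def Lp_loc_def N_def)
      obtain f' where f': "f' \<in> borel_measurable borel" "AE x in lebesgue. f x = f' x"
        using fm by (rule complex_borel_representative)
      note H = borel_measurable_hausdorff[OF \<Phi>m A det f']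
      have bound: "(\<integral>\<^sup>+x\<in>hball 0 \<rho>. ennpowr (ennreal (norm (f' x))) p\<^sub>1 * ennreal (w x) \<partial>lebesgue)
          \<le> ennpowr N p\<^sub>1 * ennpowr (?W \<rho>) (1 + p\<^sub>1 * l)" if "0 < \<rho>" for \<rho>
      proof -
        have "(\<integral>\<^sup>+x\<in>hball 0 \<rho>. ennpowr (ennreal (norm (f' x))) p\<^sub>1 * ennreal (w x) \<partial>lebesgue)
            \<le> (\<integral>\<^sup>+x\<in>hball 0 \<rho>. ennpowr (ennreal (norm (f x))) p\<^sub>1 * ennreal (w x) \<partial>lebesgue)"
          using f'(2) assms(1) by (intro nn_integral_hball_mono_AE) (auto elim: eventually_mono)
        with morrey_norm_bound[OF w pos assms(1) that, of f l] show ?thesis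
          by (simp add: N_def)
      qed
      define F where "F x = (\<integral>\<^sup>+y. ennreal (norm (\<Phi> y) / hnorm y ^ hdim TYPE('n))
          * ennreal (norm (f' (A y *v x))) \<partial>lebesgue)" for x
      have F: "(\<integral>\<^sup>+x\<in>hball 0 r. ennpowr (F x) p\<^sub>2 * ennreal (w x) \<partial>lebesgue)
          \<le> ennpowr (ennreal (C powr (1 / p\<^sub>2)) * K * N) p\<^sub>2 * ennpowr (?W r) (1 + p\<^sub>2 * l)"
        if r: "0 < r" and K: "K \<noteq> top" for r
      proof -
        have "(\<integral>\<^sup>+x\<in>hball 0 r. ennpowr (F x) p\<^sub>2 * ennreal (w x) \<partial>lebesgue)
            \<le> ennreal C * ennpowr N p\<^sub>2 * ennpowr (?W r) (1 + p\<^sub>2 * l) * ennpowr K p\<^sub>2"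
          unfolding F_def K_def
          using C(2)[OF _ _ _ r bound] f'(1) K
          by (intro hausdorff_nn_integral_le[OF w assms(2) r \<Phi>m A det f'(1)]) (auto simp: K_def)
        also have "ennreal C = ennpowr (ennreal (C powr (1 / p\<^sub>2))) p\<^sub>2"
          using C(1) assms(2) by (simp add: ennpowr_ennreal powr_powr)
        finally show ?thesis
          using assms(2) by (simp add: ennpowr_mult mult_ac)
      qed
      have HF: "(\<integral>\<^sup>+x\<in>hball 0 r. ennpowr (ennreal (norm (hausdorff \<Phi> A f x))) p\<^sub>2 * ennreal (w x) \<partial>lebesgue)
          \<le> (\<integral>\<^sup>+x\<in>hball 0 r. ennpowr (F x) p\<^sub>2 * ennreal (w x) \<partial>lebesgue)" for r
        using norm_hausdorff_le[OF \<Phi>m A det f'] assms(2)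
        by (intro nn_integral_hball_mono_AE) (simp_all add: F_def)
      have F_finite: "(\<integral>\<^sup>+x\<in>hball 0 r. ennpowr (F x) p\<^sub>2 * ennreal (w x) \<partial>lebesgue) \<noteq> top"
        if "0 < r" "K \<noteq> top" for r
      proof -
        have "ennpowr (ennreal (C powr (1 / p\<^sub>2)) * K * N) p\<^sub>2 \<noteq> top"
          using N that assms(2) by (simp add: ennpowr_eq_top_iff ennreal_mult_eq_top_iff)
        moreover have "ennpowr (?W r) (1 + p\<^sub>2 * l) \<noteq> top"
          using ennpowr_finite[OF emeasure_weight_measure_hball_pos[OF w pos that(1)] emeasure_weight_measure_hball_finite[OF w]] by simp
        ultimately show ?thesis
          using F[OF that] by (auto simp: top_unique ennreal_mult_eq_top_iff)
      qed
      have norm: "morrey_norm p\<^sub>2 l w (hausdorff \<Phi> A f) \<le> ennreal (C powr (1 / p\<^sub>2)) * K * N"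
      proof (cases "K = top")
        case False
        then show ?thesis
          by (intro morrey_norm_leI[OF w pos assms(2)] order_trans[OF HF F])
      next
        case K: True
        \<comment> \<open>the right-hand side is \<open>\<infinity>\<close> unless \<open>N = 0\<close>, where it is \<open>\<infinity> * 0 = 0\<close>\<close>
        show ?thesis
        proof (cases "N = 0")
          case False
          with K C(1) show ?thesis
            by (simp add: ennreal_mult_top ennreal_top_mult ennreal_eq_0_iff)
        next
          case True
          then have "AE x in lebesgue. f x = 0"
            by (intro morrey_norm_zero_imp_AE_zero[OF w pos assms(1) fm]) (simp add: N_def)
          then have "AE x in lebesgue. ennreal (norm (hausdorff \<Phi> A f x)) \<le> 0"
            using norm_hausdorff_le[OF \<Phi>m A det, of "\<lambda>_. 0" f] by simp
          then have "(\<integral>\<^sup>+x\<in>hball 0 r. ennpowr (ennreal (norm (hausdorff \<Phi> A f x))) p\<^sub>2 * ennreal (w x) \<partial>lebesgue)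
              \<le> (\<integral>\<^sup>+x\<in>hball 0 r. ennpowr 0 p\<^sub>2 * ennreal (w x) \<partial>lebesgue)" for r
            using assms(2) by (intro nn_integral_hball_mono_AE) auto
          then have "morrey_norm p\<^sub>2 l w (hausdorff \<Phi> A f) \<le> 0"
            using assms(2) by (intro morrey_norm_leI[OF w pos assms(2)]) (simp add: ennpowr_zero_left)
          then show ?thesis by simp
        qed
      qed
      have "AE x in weight_measure w. integrable lebesgue (hausdorff_integrand \<Phi> A f x)" if K: "K \<noteq> top"
      proof -
        have Fm: "F \<in> borel_measurable lebesgue"
        proof -
          interpret sigma_finite_measure "lebesgue :: 'n heis measure"
            by (rule sigma_finite_lebesgue)
          note [measurable] = \<Phi>m A f'(1) measurable_matrix_action[OF A, unfolded split_beta']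
          have [measurable]: "(\<lambda>y::'n heis. hnorm y) \<in> borel_measurable lebesgue"
            by (rule measurable_completion) simp
          show ?thesis
            unfolding F_def by measurable
        qed
        have "AE x in lebesgue. F x \<noteq> top"
        proof (rule AE_by_hballs[where N = 1])
          fix n :: nat assume "1 \<le> n"
          then have "AE x in lebesgue. ennpowr (F x) p\<^sub>2 * ennreal (w x) * indicator (hball 0 (real n)) x \<noteq> \<infinity>"
            using F_finite[of "real n"] K Fm by (intro nn_integral_PInf_AE) auto
          with pos show "AE x in lebesgue. x \<in> hball 0 (real n) \<longrightarrow> F x \<noteq> top"
          proof eventually_elim
            case (elim x)
            moreover have "ennreal (w x) \<noteq> 0"
              using elim(1) w by (auto simp: weight_def ennreal_eq_0_iff intro: order_antisym)
            ultimately show ?case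
              using assms(2) by (auto simp: ennpowr_top_left ennreal_top_mult)
          qed
        qed
        then have "AE x in lebesgue. integrable lebesgue (hausdorff_integrand \<Phi> A f x)"
          unfolding F_def by (rule integrable_hausdorff_integrand[OF \<Phi>m A det f'])
        then show ?thesis
          unfolding weight_measure_def by (subst AE_density) (auto elim: eventually_mono)
      qed
      moreover have "hausdorff \<Phi> A f \<in> morrey_space p\<^sub>2 l w" if K: "K \<noteq> top"
      proof -
        have "morrey_norm p\<^sub>2 l w (hausdorff \<Phi> A f) \<noteq> top"
          using norm N K by (auto simp: top_unique ennreal_mult_eq_top_iff)
        moreover have "hausdorff \<Phi> A f \<in> Lp_loc p\<^sub>2 w"
          by (intro Lp_locI[OF w assms(2) H] neq_top_trans[OF F_finite[OF _ K] HF])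
        ultimately show ?thesis
          by (simp add: morrey_space_def less_top)
      qed
      ultimately show "(hausdorff_const p\<^sub>1 q l \<delta> \<Phi> A < \<infinity> \<longrightarrow>
          (AE x in weight_measure w. integrable lebesgue (hausdorff_integrand \<Phi> A f x)) \<and>
          hausdorff \<Phi> A f \<in> morrey_space p\<^sub>2 l w) \<and>
        morrey_norm p\<^sub>2 l w (hausdorff \<Phi> A f)
          \<le> ennreal (C powr (1 / p\<^sub>2)) * hausdorff_const p\<^sub>1 q l \<delta> \<Phi> A * morrey_norm p\<^sub>1 l w f"
        using norm by (auto simp: K_def N_def)
    qed
  qed
qed

end
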